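(* Let $\mathcal{C}=\mathrm{Vect}_\Gamma\oplus\mathrm{Vect}_{\Gamma/2\Gamma}$ be the $\mathbb{Z}_2$-crossed ribbon fusion category described in the context, attached to a discriminant form $(\Gamma,Q)$ and data $(\sigma,\omega,\bar\delta,\varepsilon,q,\alpha,\beta)$, and let $X_{a,s}$, $Y_{\{b,-b\}}$, $Z_{\bar x,r}$ (for $a\in\Gamma_2$, $b\in\Gamma\setminus\Gamma_2$, $\bar x\in\Gamma/2\Gamma$, $r,s\in\{\pm1\}$) be the simple objects of the equivariantisation $\mathcal{C}/\!/\mathbb{Z}_2$ described in the context. The fusion rules of $\mathcal{C}/\!/\mathbb{Z}_2$ are (up to isomorphism): $$X_{a,s}\otimes X_{b,t}=X_{a+b,\,st\,\omega(a,b,-b)}=X_{a+b,\,st\,B_Q(a,b)},$$ $$X_{a,s}\otimes Y_{\{b,-b\}}=Y_{\{a+b,a-b\}},$$ $$X_{a,s}\otimes Z_{\bar x,r}=Z_{\bar a+\bar x,\,sr\,\omega(\bar a+\bar x,a,-a)}=Z_{\bar a+\bar x,\,sr\,B_Q(\bar a+\bar x,a)},$$ $$Y_{\{a,-a\}}\otimes Z_{\bar x,r}=Z_{\bar x+\bar a,1}\oplus Z_{\bar x+\bar a,-1},$$ $$Y_{\{b,-b\}}\otimes Y_{\{c,-c\}}=\begin{cases}X_{b+c,1}\oplus X_{b+c,-1}\oplus X_{b-c,1}\oplus X_{b-c,-1}&\text{if }b+c,b-c\in\Gamma_2,\\ Y_{\{b+c,-b-c\}}\oplus X_{b-c,1}\oplus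 X_{b-c,-1}&\text{if }b+c\notin\Gamma_2,\ b-c\in\Gamma_2,\\ Y_{\{b-c,-b+c\}}\oplus X_{b+c,1}\oplus X_{b+c,-1}&\text{if }b+c\in\Gamma_2,\ b-c\notin\Gamma_2,\\ Y_{\{b+c,-b-c\}}\oplus Y_{\{b-c,-b+c\}}&\text{if }b+c,b-c\notin\Gamma_2,\end{cases}$$ $$Z_{\bar x,r}\otimes Z_{\bar y,s}=\bigoplus_{\substack{t\in\Gamma_2\\ \bar t=\bar\delta+\bar x+\bar y}}X_{t,\,rs\,\omega(\bar x,t,-t)}\ \oplus\bigoplus_{\substack{t\in(\Gamma\setminus\Gamma_2)/2\\ \bar t=\bar\delta+\bar x+\bar y}}Y_{\{t,-t\}}=\bigoplus_{\substack{t\in\Gamma_2\\ \bar t=\bar\delta+\bar x+\bar y}}X_{t,\,rs\,B_Q(\bar x,t)}\ \oplus\bigoplus_{\substack{t\in(\Gamma\setminus\Gamma_2)/2\\ \bar t=\bar\delta+\bar x+\bar y}}Y_{\{t,-t\}}.$$ Here $t\in(\Gamma\setminus\Gamma_2)/2$ indicates that one of $t$ or $-t$ is selected for each pair $\{t,-t\}\subset\Gamma\setminus\Gamma_2$.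
   Context: All categories are $\mathbb{C}$-linear. **Input data.** A discriminant form $(\Gamma,Q)$ is a finite abelian group $\Gamma$ (written additively) with a nondegenerate quadratic form $Q\colon\Gamma\to\mathbb{C}^\times$: $Q(na)=Q(a)^{n^2}$ for $n\in\mathbb{Z}$, and $B_Q(a,b)=Q(a+b)Q(a)^{-1}Q(b)^{-1}$ is bimultiplicative and nondegenerate. Fix functions $\sigma\colon\Gamma^2\to\mathbb{C}^\times$, $\omega\colon\Gamma^3\to\{\pm1\}$ with: $\sigma(a,a)=Q(a)$; $\sigma(a,0)=\sigma(0,a)=1$; $\sigma(a,b)=\sigma(b,a)$; $\omega(a,b,c)=\sigma(a,b+c)\sigma(a,b)^{-1}\sigma(a,c)^{-1}$; and for fixed $b,c$ the map $\omega(\cdot,b,c)\colon\Gamma\to\{\pm1\}$ is a group homomorphism (so it factors through $\Gamma/2\Gamma$, and we allow the first argument of $\omega$ to lie in $\Gamma/2\Gamma$). For $x\in\Gamma$, $\bar x$ denotes its class in $\Gamma/2\Gamma$. Put $\Gamma_2=\{a\in\Gamma\mid 2a=0\}$; for $a\in\Gamma_2$ the map $B_Q(\cdot,a)$ takes values in $\{\pm1\}$ and factors through $\Gamma/2\Gamma$, which gives meaning to $B_Q(\bar x,a)$. Fix $\bar\delta\in\Gamma/2\Gamma$ and $q\colon\Gamma\to\mathbb{C}^\times$ with $q(a)^2=Q(a)$ and $q(a+b)q(a)^{-1}q(b)^{-1}=\sigma(a,b)\,\omega(a+b,a,b)\,\omega(\bar\delta,a,b)$ for all $a,b\in\Gamma$.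 Fix $\varepsilon\in\{\pm1\}$, a square root $\alpha$ of $\varepsilon\,G_{\bar\delta}(\Gamma,q^{-1})$, where $G_{\bar\delta}(\Gamma,q^{-1})=|2\Gamma|^{-1/2}\sum_{a\in\bar\delta}q(a)^{-1}$, and $\beta\in\{\alpha^{-1},-\alpha^{-1}\}$. **The category $\mathcal{C}=\mathcal{C}_1\oplus\mathcal{C}_g$** (with $G=\langle g\rangle\cong\mathbb{Z}_2$). It is semisimple, with simple objects $\mathbb{C}_a$ ($a\in\Gamma$) in $\mathcal{C}_1$ and $\mathsf{X}^{\bar x}$ ($\bar x\in\Gamma/2\Gamma$) in $\mathcal{C}_g$. Tensor product: $\mathbb{C}_a\otimes\mathbb{C}_b=\mathbb{C}_{a+b}$, $\mathbb{C}_a\otimes\mathsf{X}^{\bar x}=\mathsf{X}^{\bar a+\bar x}=\mathsf{X}^{\bar x}\otimes\mathbb{C}_a$, $\mathsf{X}^{\bar x}\otimes\mathsf{X}^{\bar y}=\bigoplus_{t\in\bar\delta+\bar x+\bar y}\mathbb{C}_t$. Associator $(A\otimes B)\otimes C\to A\otimes(B\otimes C)$ (with $e_t$ the basis vector of the summand $\mathbb{C}_t$ of a product of two $\mathsf{X}$'s): - $(\mathbb{C}_a,\mathbb{C}_b,\mathbb{C}_c)$: $\omega(a,b,c)$; - $(\mathsf{X}^{\bar x},\mathbb{C}_a,\mathbb{C}_b)$: $\omega(\bar x+\bar\delta,a,b)$; - $(\mathbb{C}_a,\mathsf{X}^{\bar x},\mathbb{C}_b)$: $\sigma(a,b)$;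 - $(\mathbb{C}_a,\mathbb{C}_b,\mathsf{X}^{\bar x})$: $\omega(\bar a+\bar b+\bar x,a,b)$; - $(\mathbb{C}_a,\mathsf{X}^{\bar x},\mathsf{X}^{\bar y})$: $e_{a+t}\mapsto\omega(\bar a+\bar x,a,t)\,e_a\otimes e_t$; - $(\mathsf{X}^{\bar x},\mathsf{X}^{\bar y},\mathbb{C}_a)$: $e_t\otimes e_a\mapsto\omega(\bar x,t,a)\,e_{t+a}$; - $(\mathsf{X}^{\bar x},\mathbb{C}_a,\mathsf{X}^{\bar y})$: $e_t\mapsto\sigma(a,t)\,e_t$; - $(\mathsf{X}^{\bar x},\mathsf{X}^{\bar y},\mathsf{X}^{\bar z})$: the map $\bigoplus_{t\in\bar\delta+\bar x+\bar y}\mathsf{X}^{\bar t+\bar z}\to\bigoplus_{r\in\bar\delta+\bar y+\bar z}\mathsf{X}^{\bar x+\bar r}$ whose component from the $t$-summand to the $r$-summand is $\varepsilon|2\Gamma|^{-1/2}\sigma(t,r)^{-1}$. $\mathbb{Z}_2$-action: $g_*\mathbb{C}_a=\mathbb{C}_{-a}$, $g_*\mathsf{X}^{\bar x}=\mathsf{X}^{\bar x}$, strict composition ($g_*g_*=\mathrm{id}$), tensor structure $\tau^g\colon g_*(A\otimes B)\to g_*A\otimes g_*B$: $\omega(a,b,-b)$ on $(\mathbb{C}_a,\mathbb{C}_b)$; $\omega(\bar a+\bar x,a,-a)$ on $(\mathbb{C}_a,\mathsf{X}^{\bar x})$; $\omega(\bar x+\bar\delta,a,-a)$ on $(\mathsf{X}^{\bar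 x},\mathbb{C}_a)$; $\omega(\bar x,t,-t)$ on the summand $t$ of $(\mathsf{X}^{\bar x},\mathsf{X}^{\bar y})$. $\mathbb{Z}_2$-braiding $c_{A,B}\colon A\otimes B\to h_*(B)\otimes A$ for $A\in\mathcal{C}_h$: $\sigma(a,b)$ on $\mathbb{C}_a\otimes\mathbb{C}_b$; $q(a)^{-1}$ on $\mathbb{C}_a\otimes\mathsf{X}^{\bar x}$; $q(a)^{-1}\omega(\bar x+\bar a,a,-a)$ on $\mathsf{X}^{\bar x}\otimes\mathbb{C}_a\to\mathbb{C}_{-a}\otimes\mathsf{X}^{\bar x}$; $\alpha q(t)$ on the summand $\mathbb{C}_t$ of $\mathsf{X}^{\bar x}\otimes\mathsf{X}^{\bar y}\to\mathsf{X}^{\bar y}\otimes\mathsf{X}^{\bar x}$. Ribbon twist: $\theta_{\mathbb{C}_a}=\sigma(a,a)$, $\theta_{\mathsf{X}^{\bar x}}=\beta$. These data define a braided $\mathbb{Z}_2$-crossed fusion category with a $\mathbb{Z}_2$-ribbon structure (this may be taken as given). **Equivariantisation.** Objects of $\mathcal{C}/\!/\mathbb{Z}_2$ are pairs $(X,\varphi)$ with $X\in\mathcal{C}$ and an isomorphism $\varphi_g\colon g_*X\to X$ with $\varphi_g\circ g_*(\varphi_g)=\mathrm{id}_X$; morphisms $f\colon(X,\varphi)\to(Y,\varphi')$ satisfy $\varphi'_g\circ g_*(f)=f\circ\varphi_g$; the tensor product is $(X,\varphi)\otimes(Y,\varphi')=(X\otimes Y,(\varphi_g\otimes\varphi'_g)\circ\tau^g_{X,Y})$.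 **Simple objects.** Up to isomorphism they are: $X_{a,s}=\mathbb{C}_a$ with $\varphi_g=s\,\mathrm{id}$ ($a\in\Gamma_2$, $s\in\{\pm1\}$); $Y_{\{b,-b\}}=\mathbb{C}_b\oplus\mathbb{C}_{-b}$ with $\varphi_g$ interchanging the summands ($b\in\Gamma\setminus\Gamma_2$); $Z_{\bar x,r}=\mathsf{X}^{\bar x}$ with $\varphi_g=r\,\mathrm{id}$ ($\bar x\in\Gamma/2\Gamma$, $r\in\{\pm1\}$). *)

theory Defs
  imports Complex_Main
begin

section \<open>The quotient of an abelian group by its doubles\<close>

quotient_type (overloaded) 'g mod2 = "'g::ab_group_add" / "\<lambda>a b. \<exists>c. a - b = c + c"
  morphisms rep_mod2 cls
proof (rule equivpI)
  show "reflp (\<lambda>a b::'g. \<exists>c. a - b = c + c)"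
    by (auto simp: reflp_def intro: exI[of _ 0])
  show "symp (\<lambda>a b::'g. \<exists>c. a - b = c + c)"
  proof (rule sympI)
    fix a b :: 'g assume "\<exists>c. a - b = c + c"
    then obtain c where "a - b = c + c" ..
    then have "b - a = - c + - c" by (metis minus_add_distrib minus_diff_eq add.commute)
    then show "\<exists>c. b - a = c + c" ..
  qed
  show "transp (\<lambda>a b::'g. \<exists>c. a - b = c + c)"
  proof (rule transpI)
    fix a b c :: 'g assume "\<exists>d. a - b = d + d" "\<exists>d. b - c = d + d"
    then obtain d e where "a - b = d + d" "b - c = e + e" by blast
    then have "a - c = (d + e) + (d + e)" by (simp add: algebra_simps)
    then show "\<exists>d. a - c = d + d" ..
  qed
qed

instantiation mod2 :: (ab_group_add) ab_group_add
begin

lift_definition zero_mod2 :: "'a mod2" is 0 .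

lift_definition plus_mod2 :: "'a mod2 \<Rightarrow> 'a mod2 \<Rightarrow> 'a mod2" is "(+)"
proof -
  fix a b c d :: 'a assume "\<exists>e. a - b = e + e" "\<exists>e. c - d = e + e"
  then obtain e f where "a - b = e + e" "c - d = f + f" by blast
  then have "(a + c) - (b + d) = (e + f) + (e + f)" by (simp add: algebra_simps)
  then show "\<exists>e. (a + c) - (b + d) = e + e" ..
qed

lift_definition uminus_mod2 :: "'a mod2 \<Rightarrow> 'a mod2" is uminus
proof -
  fix a b :: 'a assume "\<exists>e. a - b = e + e"
  then obtain e where "a - b = e + e" ..
  then have "- a - - b = - e + - e" by (metis minus_add_distrib minus_diff_minus)
  then show "\<exists>e. - a - - b = e + e" ..
qed

definition minus_mod2 :: "'a mod2 \<Rightarrow> 'a mod2 \<Rightarrow> 'a mod2" where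
  "minus_mod2 x y = x + - y"

instance
proof
  fix a b c :: "'a mod2"
  show "a + b + c = a + (b + c)"
    by transfer (rule exI[of _ 0], simp add: algebra_simps)
  show "a + b = b + a"
    by transfer (rule exI[of _ 0], simp add: algebra_simps)
  show "0 + a = a"
    by transfer (rule exI[of _ 0], simp)
  show "- a + a = 0"
    by transfer (rule exI[of _ 0], simp)
  show "a - b = a + - b"
    by (fact minus_mod2_def)
qed

end

lemma cls_eq_iff: "cls a = cls b \<longleftrightarrow> (\<exists>c. a - b = c + c)"
  by (rule mod2.abs_eq_iff)

lemma cls_add: "cls (a + b) = cls a + cls b"
  by (simp add: plus_mod2.abs_eq)

lemma cls_rep [simp]: "cls (rep_mod2 x) = x"
  by (rule Quotient_abs_rep[OF Quotient_mod2])


section \<open>Discriminant forms and the input data\<close>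

definition int_mult :: "int \<Rightarrow> 'g::ab_group_add \<Rightarrow> 'g" where
  "int_mult n a = (if 0 \<le> n then (\<Sum>i<nat n. a) else - (\<Sum>i<nat (- n). a))"

definition two_torsion :: "'g::ab_group_add set" where
  "two_torsion = {a. a + a = 0}"

definition bil :: "('g::ab_group_add \<Rightarrow> complex) \<Rightarrow> 'g \<Rightarrow> 'g \<Rightarrow> complex" where
  "bil Q a b = Q (a + b) * inverse (Q a) * inverse (Q b)"

locale discriminant_form =
  fixes Q :: "'g::{finite, ab_group_add} \<Rightarrow> complex"
  assumes Q_nonzero: "Q a \<noteq> 0"
    and Q_quadratic: "Q (int_mult n a) = Q a ^ nat (n\<^sup>2)"
    and bil_left: "bil Q (a + b) c = bil Q a c * bil Q b c"
    and bil_right: "bil Q a (b + c) = bil Q a b * bil Q a c"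
    and bil_nondegenerate: "(\<forall>b. bil Q a b = 1) \<Longrightarrow> a = 0"

text \<open>Extension to \<open>\<Gamma>/2\<Gamma>\<close> in the first argument by means of a chosen representative. This is
  only used for functions for which the choice is immaterial: \<open>\<omega>\<close> and \<open>B\<^sub>Q(-, a)\<close> with \<open>2a = 0\<close>
  (see \<open>bar_omega\<close> and \<open>bar_bil_cls\<close> below).\<close>

definition bar3 :: "('g::ab_group_add \<Rightarrow> 'g \<Rightarrow> 'g \<Rightarrow> complex) \<Rightarrow> 'g mod2 \<Rightarrow> 'g \<Rightarrow> 'g \<Rightarrow> complex" where
  "bar3 \<omega> x b c = \<omega> (rep_mod2 x) b c"

definition bar_bil :: "('g::ab_group_add \<Rightarrow> complex) \<Rightarrow> 'g mod2 \<Rightarrow> 'g \<Rightarrow> complex" where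
  "bar_bil Q x a = bil Q (rep_mod2 x) a"

abbreviation sqrt_card_2G :: "'g::{finite, ab_group_add} itself \<Rightarrow> complex" where
  "sqrt_card_2G _ \<equiv> complex_of_real (sqrt (real (card (range (\<lambda>a::'g. a + a)))))"

definition gauss_sum :: "'g::{finite, ab_group_add} mod2 \<Rightarrow> ('g \<Rightarrow> complex) \<Rightarrow> complex" where
  "gauss_sum \<delta> f = inverse (sqrt_card_2G TYPE('g)) * (\<Sum>a | cls a = \<delta>. f a)"

locale crossed_input = discriminant_form Q
  for Q :: "'g::{finite, ab_group_add} \<Rightarrow> complex" +
  fixes \<sigma> :: "'g \<Rightarrow> 'g \<Rightarrow> complex"
    and \<omega> :: "'g \<Rightarrow> 'g \<Rightarrow> 'g \<Rightarrow> complex"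
    and \<delta> :: "'g mod2"
    and q :: "'g \<Rightarrow> complex"
    and \<epsilon> \<alpha> \<beta> :: complex
  assumes \<sigma>_nonzero: "\<sigma> a b \<noteq> 0"
    and \<sigma>_diag: "\<sigma> a a = Q a"
    and \<sigma>_zero_right: "\<sigma> a 0 = 1"
    and \<sigma>_zero_left: "\<sigma> 0 a = 1"
    and \<sigma>_sym: "\<sigma> a b = \<sigma> b a"
    and \<omega>_values: "\<omega> a b c \<in> {1, -1}"
    and \<omega>_\<sigma>: "\<omega> a b c = \<sigma> a (b + c) * inverse (\<sigma> a b) * inverse (\<sigma> a c)"
    and \<omega>_hom: "\<omega> (a + a') b c = \<omega> a b c * \<omega> a' b c"
    and q_nonzero: "q a \<noteq> 0"
    and q_square: "(q a)\<^sup>2 = Q a"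
    and q_add: "q (a + b) * inverse (q a) * inverse (q b) = \<sigma> a b * \<omega> (a + b) a b * bar3 \<omega> \<delta> a b"
    and \<epsilon>_values: "\<epsilon> \<in> {1, -1}"
    and \<alpha>_square: "\<alpha>\<^sup>2 = \<epsilon> * gauss_sum \<delta> (\<lambda>a. inverse (q a))"
    and \<beta>_values: "\<beta> \<in> {inverse \<alpha>, - inverse \<alpha>}"
begin

lemma bar_omega: "bar3 \<omega> (cls a) b c = \<omega> a b c"
proof -
  have "cls a = cls (rep_mod2 (cls a))" by simp
  then obtain d where "a - rep_mod2 (cls a) = d + d" unfolding cls_eq_iff by blast
  then have "a = rep_mod2 (cls a) + (d + d)" by (simp add: algebra_simps)
  then have "\<omega> a b c = \<omega> (rep_mod2 (cls a)) b c * (\<omega> d b c * \<omega> d b c)"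
    by (metis \<omega>_hom)
  moreover have "\<omega> d b c * \<omega> d b c = 1" using \<omega>_values[of d b c] by auto
  ultimately show ?thesis by (simp add: bar3_def)
qed

lemma bar_bil_cls:
  assumes "a \<in> two_torsion" shows "bar_bil Q (cls x) a = bil Q x a"
proof -
  have "cls x = cls (rep_mod2 (cls x))" by simp
  then obtain d where "x - rep_mod2 (cls x) = d + d" unfolding cls_eq_iff by blast
  then have "x = rep_mod2 (cls x) + (d + d)" by (simp add: algebra_simps)
  then have "bil Q x a = bil Q (rep_mod2 (cls x)) a * bil Q d (a + a)"
    by (metis bil_left bil_right)
  moreover have "bil Q d 0 = 1"
    using bil_right[of d 0 0] bil_left[of d "-d" 0] Q_nonzero by (auto simp: bil_def)
  ultimately show ?thesis using assms by (simp add: bar_bil_def two_torsion_def)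
qed

end


section \<open>Tensor categories and \<open>\<int>\<^sub>2\<close>-crossed categories\<close>

text \<open>Morphisms do not carry their source and target, hence composition and the tensor product of
  morphisms take the objects as arguments: \<open>Comp C A B D g f\<close> is \<open>g \<circ> f\<close> for
  \<open>f : A \<rightarrow> B\<close> and \<open>g : B \<rightarrow> D\<close>, and \<open>TensM C A A' B B' f h : A \<otimes> B \<rightarrow> A' \<otimes> B'\<close>
  for \<open>f : A \<rightarrow> A'\<close> and \<open>h : B \<rightarrow> B'\<close>. \<open>Assoc C A B D\<close> goes from
  \<open>(A \<otimes> B) \<otimes> D\<close> to \<open>A \<otimes> (B \<otimes> D)\<close>. The records only collect the data.\<close>

record ('o, 'm) tensor_cat =
  Ob :: "'o set"
  Hom :: "'o \<Rightarrow> 'o \<Rightarrow> 'm set"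
  Id :: "'o \<Rightarrow> 'm"
  Comp :: "'o \<Rightarrow> 'o \<Rightarrow> 'o \<Rightarrow> 'm \<Rightarrow> 'm \<Rightarrow> 'm"
  TensO :: "'o \<Rightarrow> 'o \<Rightarrow> 'o" (infixl "\<otimes>\<index>" 70)
  TensM :: "'o \<Rightarrow> 'o \<Rightarrow> 'o \<Rightarrow> 'o \<Rightarrow> 'm \<Rightarrow> 'm \<Rightarrow> 'm"
  Assoc :: "'o \<Rightarrow> 'o \<Rightarrow> 'o \<Rightarrow> 'm"

text \<open>The nontrivial element \<open>g\<close> of \<open>\<int>\<^sub>2\<close> is \<open>True\<close>, so \<open>Homog C h\<close> are the objects of the
  component \<open>\<C>\<^sub>h\<close>. \<open>ActO\<close> and \<open>ActM\<close> form the functor \<open>g\<^sub>*\<close>, whose square is the identity functor,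
  and \<open>Tau C A B : g\<^sub>*(A \<otimes> B) \<rightarrow> g\<^sub>*A \<otimes> g\<^sub>*B\<close>. For \<open>A \<in> Homog C h\<close>,
  \<open>Braid C A B : A \<otimes> B \<rightarrow> h\<^sub>*B \<otimes> A\<close> and \<open>Twist C A : A \<rightarrow> h\<^sub>*A\<close>.\<close>

record ('o, 'm) crossed_cat = "('o, 'm) tensor_cat" +
  Homog :: "bool \<Rightarrow> 'o set"
  ActO :: "'o \<Rightarrow> 'o"
  ActM :: "'m \<Rightarrow> 'm"
  Tau :: "'o \<Rightarrow> 'o \<Rightarrow> 'm"
  Braid :: "'o \<Rightarrow> 'o \<Rightarrow> 'm"
  Twist :: "'o \<Rightarrow> 'm"

definition inverse_morphisms ::
  "('o, 'm, 'z) tensor_cat_scheme \<Rightarrow> 'o \<Rightarrow> 'o \<Rightarrow> 'm \<Rightarrow> 'm \<Rightarrow> bool" where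
  "inverse_morphisms C A B f h \<longleftrightarrow> f \<in> Hom C A B \<and> h \<in> Hom C B A \<and>
     Comp C A B A h f = Id C A \<and> Comp C B A B f h = Id C B"

definition isomorphic :: "('o, 'm, 'z) tensor_cat_scheme \<Rightarrow> 'o \<Rightarrow> 'o \<Rightarrow> bool"
    ("(_/ \<cong>\<index> _)" [51, 51] 50) where
  "isomorphic C A B \<longleftrightarrow> A \<in> Ob C \<and> B \<in> Ob C \<and> (\<exists>f h. inverse_morphisms C A B f h)"

definition equivariantisation ::
  "('o, 'm, 'z) crossed_cat_scheme \<Rightarrow> ('o \<times> 'm, 'm) tensor_cat" where
  "equivariantisation C = \<lparr>
     Ob = {(A, \<phi>). A \<in> Ob C \<and> (\<exists>\<psi>. inverse_morphisms C (ActO C A) A \<phi> \<psi>) \<and>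
            Comp C (ActO C (ActO C A)) (ActO C A) A \<phi> (ActM C \<phi>) = Id C A},
     Hom = (\<lambda>(A, \<phi>) (B, \<psi>). {f \<in> Hom C A B.
            Comp C (ActO C A) (ActO C B) B \<psi> (ActM C f) = Comp C (ActO C A) A B f \<phi>}),
     Id = (\<lambda>P. Id C (fst P)),
     Comp = (\<lambda>P R S. Comp C (fst P) (fst R) (fst S)),
     TensO = (\<lambda>(A, \<phi>) (B, \<psi>). (A \<otimes>\<^bsub>C\<^esub> B,
            Comp C (ActO C (A \<otimes>\<^bsub>C\<^esub> B)) (ActO C A \<otimes>\<^bsub>C\<^esub> ActO C B) (A \<otimes>\<^bsub>C\<^esub> B)
              (TensM C (ActO C A) A (ActO C B) B \<phi> \<psi>) (Tau C A B))),
     TensM = (\<lambda>P P' R R'. TensM C (fst P) (fst P') (fst R) (fst R')),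
     Assoc = (\<lambda>P R S. Assoc C (fst P) (fst R) (fst S)) \<rparr>"


section \<open>The category \<open>Vect\<^sub>\<Gamma> \<oplus> Vect\<^bsub>\<Gamma>/2\<Gamma>\<^esub>\<close>\<close>

datatype ('a, 'x) graded_simple = SC 'a | SX 'x

type_synonym 'g simple = "('g, 'g mod2) graded_simple"

text \<open>An object is a finite formal direct sum of simple objects: a finite set of summands, each
  labelled by a simple object. A morphism is a complex matrix \<open>f\<close> whose entry \<open>f j i\<close>, the component
  from summand \<open>i\<close> of the source to summand \<open>j\<close> of the target, vanishes unless both have the same
  label. The names of the summands come from a fixed type closed under the operations needed:
  \<open>Ten i j u\<close> is the summand \<open>u\<close> of the product of the simple summands \<open>i\<close> and \<open>j\<close>; \<open>InL\<close>, \<open>InR\<close>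
  and \<open>At t\<close> tag the summands of binary and indexed direct sums.\<close>

datatype 's summand = Leaf 's | Ten "'s summand" "'s summand" 's
  | InL "'s summand" | InR "'s summand" | At 's "'s summand"

datatype 's obj = Obj (summands: "'s summand set") (label: "'s summand \<Rightarrow> 's")

type_synonym 's mor = "'s summand \<Rightarrow> 's summand \<Rightarrow> complex"

definition mor_hom :: "'s obj \<Rightarrow> 's obj \<Rightarrow> 's mor set" where
  "mor_hom A B = {f. \<forall>j i. f j i \<noteq> 0 \<longrightarrow>
     i \<in> summands A \<and> j \<in> summands B \<and> label A i = label B j}"

definition mor_id :: "'s obj \<Rightarrow> 's mor" where
  "mor_id A = (\<lambda>j i. if i \<in> summands A \<and> j = i then 1 else 0)"

definition mor_comp :: "'s obj \<Rightarrow> 's obj \<Rightarrow> 's obj \<Rightarrow> 's mor \<Rightarrow> 's mor \<Rightarrow> 's mor" where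
  "mor_comp A B D g f = (\<lambda>k i. \<Sum>j\<in>summands B. g k j * f j i)"

fun simple_tensor :: "'g::ab_group_add mod2 \<Rightarrow> 'g simple \<Rightarrow> 'g simple \<Rightarrow> 'g simple set" where
  "simple_tensor \<delta> (SC a) (SC b) = {SC (a + b)}"
| "simple_tensor \<delta> (SC a) (SX x) = {SX (cls a + x)}"
| "simple_tensor \<delta> (SX x) (SC a) = {SX (cls a + x)}"
| "simple_tensor \<delta> (SX x) (SX y) = {SC t | t. cls t = \<delta> + x + y}"

definition obj_tensor :: "'g::ab_group_add mod2 \<Rightarrow> 'g simple obj \<Rightarrow> 'g simple obj \<Rightarrow> 'g simple obj"
  where "obj_tensor \<delta> A B = Obj
     {Ten i j u | i j u. i \<in> summands A \<and> j \<in> summands B \<and> u \<in> simple_tensor \<delta> (label A i) (label B j)}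
     (\<lambda>k. case k of Ten i j u \<Rightarrow> u | _ \<Rightarrow> undefined)"

definition mor_tensor :: "'g::ab_group_add mod2 \<Rightarrow> 'g simple obj \<Rightarrow> 'g simple obj \<Rightarrow>
    'g simple obj \<Rightarrow> 'g simple obj \<Rightarrow> 'g simple mor \<Rightarrow> 'g simple mor \<Rightarrow> 'g simple mor" where
  "mor_tensor \<delta> A A' B B' f h = (\<lambda>k' k. case (k', k) of
     (Ten i' j' u', Ten i j u) \<Rightarrow>
       if k \<in> summands (obj_tensor \<delta> A B) \<and> k' \<in> summands (obj_tensor \<delta> A' B') \<and> u' = u
       then f i' i * h j' j else 0
   | _ \<Rightarrow> 0)"

text \<open>\<open>assoc_coeff \<sigma> \<omega> \<delta> \<epsilon> A B C u w v\<close> is the component of the associator of the simple objects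
  \<open>A, B, C\<close> from the summand \<open>u \<otimes> C\<close> of \<open>(A \<otimes> B) \<otimes> C\<close>, with \<open>u\<close> in \<open>A \<otimes> B\<close>, to the summand
  \<open>A \<otimes> w\<close> of \<open>A \<otimes> (B \<otimes> C)\<close>, with \<open>w\<close> in \<open>B \<otimes> C\<close>, on the simple object \<open>v\<close> common to both.\<close>

fun assoc_coeff :: "('g::{finite, ab_group_add} \<Rightarrow> 'g \<Rightarrow> complex) \<Rightarrow> ('g \<Rightarrow> 'g \<Rightarrow> 'g \<Rightarrow> complex) \<Rightarrow>
    'g mod2 \<Rightarrow> complex \<Rightarrow> 'g simple \<Rightarrow> 'g simple \<Rightarrow> 'g simple \<Rightarrow>
    'g simple \<Rightarrow> 'g simple \<Rightarrow> 'g simple \<Rightarrow> complex" where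
  "assoc_coeff \<sigma> \<omega> \<delta> \<epsilon> (SC a) (SC b) (SC c) u w v = \<omega> a b c"
| "assoc_coeff \<sigma> \<omega> \<delta> \<epsilon> (SX x) (SC a) (SC b) u w v = bar3 \<omega> (x + \<delta>) a b"
| "assoc_coeff \<sigma> \<omega> \<delta> \<epsilon> (SC a) (SX x) (SC b) u w v = \<sigma> a b"
| "assoc_coeff \<sigma> \<omega> \<delta> \<epsilon> (SC a) (SC b) (SX x) u w v = bar3 \<omega> (cls a + cls b + x) a b"
| "assoc_coeff \<sigma> \<omega> \<delta> \<epsilon> (SC a) (SX x) (SX y) u w v =
     (case w of SC t \<Rightarrow> bar3 \<omega> (cls a + x) a t | _ \<Rightarrow> 0)"
| "assoc_coeff \<sigma> \<omega> \<delta> \<epsilon> (SX x) (SX y) (SC a) u w v =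
     (case u of SC t \<Rightarrow> bar3 \<omega> x t a | _ \<Rightarrow> 0)"
| "assoc_coeff \<sigma> \<omega> \<delta> \<epsilon> (SX x) (SC a) (SX y) u w v =
     (case v of SC t \<Rightarrow> \<sigma> a t | _ \<Rightarrow> 0)"
| "assoc_coeff \<sigma> \<omega> \<delta> \<epsilon> (SX x) (SX y) (SX z) u w v = (case (u, w) of
       (SC t, SC r) \<Rightarrow> \<epsilon> * inverse (sqrt_card_2G TYPE('g)) * inverse (\<sigma> t r)
     | _ \<Rightarrow> 0)"

definition mor_assoc :: "('g::{finite, ab_group_add} \<Rightarrow> 'g \<Rightarrow> complex) \<Rightarrow>
    ('g \<Rightarrow> 'g \<Rightarrow> 'g \<Rightarrow> complex) \<Rightarrow> 'g mod2 \<Rightarrow> complex \<Rightarrow>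
    'g simple obj \<Rightarrow> 'g simple obj \<Rightarrow> 'g simple obj \<Rightarrow> 'g simple mor" where
  "mor_assoc \<sigma> \<omega> \<delta> \<epsilon> A B C = (\<lambda>k' k. case (k', k) of
     (Ten i' (Ten j' l' w) v', Ten (Ten i j u) l v) \<Rightarrow>
       if k \<in> summands (obj_tensor \<delta> (obj_tensor \<delta> A B) C) \<and>
          k' \<in> summands (obj_tensor \<delta> A (obj_tensor \<delta> B C)) \<and>
          i' = i \<and> j' = j \<and> l' = l \<and> v' = v
       then assoc_coeff \<sigma> \<omega> \<delta> \<epsilon> (label A i) (label B j) (label C l) u w v else 0
   | _ \<Rightarrow> 0)"

fun simple_act :: "'g::ab_group_add simple \<Rightarrow> 'g simple" where
  "simple_act (SC a) = SC (- a)"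
| "simple_act (SX x) = SX x"

definition obj_act :: "'g::ab_group_add simple obj \<Rightarrow> 'g simple obj" where
  "obj_act A = Obj (summands A) (\<lambda>i. simple_act (label A i))"

text \<open>Since \<open>obj_act\<close> only changes labels, \<open>g\<^sub>*\<close> is the identity on matrices.\<close>

definition mor_act :: "'s mor \<Rightarrow> 's mor" where
  "mor_act f = f"

text \<open>The last argument is the summand of the product of the first two simple objects, before
  \<open>g\<^sub>*\<close> is applied; likewise in \<open>braid_coeff\<close>.\<close>

fun tau_coeff :: "('g::ab_group_add \<Rightarrow> 'g \<Rightarrow> 'g \<Rightarrow> complex) \<Rightarrow> 'g mod2 \<Rightarrow>
    'g simple \<Rightarrow> 'g simple \<Rightarrow> 'g simple \<Rightarrow> complex" where
  "tau_coeff \<omega> \<delta> (SC a) (SC b) u = \<omega> a b (- b)"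
| "tau_coeff \<omega> \<delta> (SC a) (SX x) u = bar3 \<omega> (cls a + x) a (- a)"
| "tau_coeff \<omega> \<delta> (SX x) (SC a) u = bar3 \<omega> (x + \<delta>) a (- a)"
| "tau_coeff \<omega> \<delta> (SX x) (SX y) u = (case u of SC t \<Rightarrow> bar3 \<omega> x t (- t) | _ \<Rightarrow> 0)"

definition mor_tau :: "('g::ab_group_add \<Rightarrow> 'g \<Rightarrow> 'g \<Rightarrow> complex) \<Rightarrow> 'g mod2 \<Rightarrow>
    'g simple obj \<Rightarrow> 'g simple obj \<Rightarrow> 'g simple mor" where
  "mor_tau \<omega> \<delta> A B = (\<lambda>k' k. case (k', k) of
     (Ten i' j' u', Ten i j u) \<Rightarrow>
       if k \<in> summands (obj_tensor \<delta> A B) \<and> i' = i \<and> j' = j \<and> u' = simple_act u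
       then tau_coeff \<omega> \<delta> (label A i) (label B j) u else 0
   | _ \<Rightarrow> 0)"

fun braid_coeff :: "('g::ab_group_add \<Rightarrow> 'g \<Rightarrow> complex) \<Rightarrow> ('g \<Rightarrow> 'g \<Rightarrow> 'g \<Rightarrow> complex) \<Rightarrow>
    ('g \<Rightarrow> complex) \<Rightarrow> complex \<Rightarrow> 'g simple \<Rightarrow> 'g simple \<Rightarrow> 'g simple \<Rightarrow> complex" where
  "braid_coeff \<sigma> \<omega> q \<alpha> (SC a) (SC b) u = \<sigma> a b"
| "braid_coeff \<sigma> \<omega> q \<alpha> (SC a) (SX x) u = inverse (q a)"
| "braid_coeff \<sigma> \<omega> q \<alpha> (SX x) (SC a) u = inverse (q a) * bar3 \<omega> (x + cls a) a (- a)"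
| "braid_coeff \<sigma> \<omega> q \<alpha> (SX x) (SX y) u = (case u of SC t \<Rightarrow> \<alpha> * q t | _ \<Rightarrow> 0)"

definition mor_braid :: "('g::ab_group_add \<Rightarrow> 'g \<Rightarrow> complex) \<Rightarrow> ('g \<Rightarrow> 'g \<Rightarrow> 'g \<Rightarrow> complex) \<Rightarrow>
    'g mod2 \<Rightarrow> ('g \<Rightarrow> complex) \<Rightarrow> complex \<Rightarrow> 'g simple obj \<Rightarrow> 'g simple obj \<Rightarrow> 'g simple mor" where
  "mor_braid \<sigma> \<omega> \<delta> q \<alpha> A B = (\<lambda>k' k. case (k', k) of
     (Ten j' i' u', Ten i j u) \<Rightarrow>
       if k \<in> summands (obj_tensor \<delta> A B) \<and> i' = i \<and> j' = j \<and> u' = u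
       then braid_coeff \<sigma> \<omega> q \<alpha> (label A i) (label B j) u else 0
   | _ \<Rightarrow> 0)"

fun twist_coeff :: "('g \<Rightarrow> 'g \<Rightarrow> complex) \<Rightarrow> complex \<Rightarrow> 'g::ab_group_add simple \<Rightarrow> complex" where
  "twist_coeff \<sigma> \<beta> (SC a) = \<sigma> a a"
| "twist_coeff \<sigma> \<beta> (SX x) = \<beta>"

definition mor_twist ::
  "('g \<Rightarrow> 'g \<Rightarrow> complex) \<Rightarrow> complex \<Rightarrow> 'g::ab_group_add simple obj \<Rightarrow> 'g simple mor" where
  "mor_twist \<sigma> \<beta> A =
     (\<lambda>j i. if i \<in> summands A \<and> j = i then twist_coeff \<sigma> \<beta> (label A i) else 0)"

definition crossed_category :: "('g::{finite, ab_group_add} \<Rightarrow> 'g \<Rightarrow> complex) \<Rightarrow>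
    ('g \<Rightarrow> 'g \<Rightarrow> 'g \<Rightarrow> complex) \<Rightarrow> 'g mod2 \<Rightarrow> ('g \<Rightarrow> complex) \<Rightarrow> complex \<Rightarrow> complex \<Rightarrow> complex \<Rightarrow>
    ('g simple obj, 'g simple mor) crossed_cat" where
  "crossed_category \<sigma> \<omega> \<delta> q \<epsilon> \<alpha> \<beta> = \<lparr>
     Ob = {A. finite (summands A)},
     Hom = mor_hom,
     Id = mor_id,
     Comp = mor_comp,
     TensO = obj_tensor \<delta>,
     TensM = mor_tensor \<delta>,
     Assoc = mor_assoc \<sigma> \<omega> \<delta> \<epsilon>,
     Homog = (\<lambda>h. {A. finite (summands A) \<and>
                (\<forall>i\<in>summands A. label A i \<in> (if h then range SX else range SC))}),
     ActO = obj_act,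
     ActM = mor_act,
     Tau = mor_tau \<omega> \<delta>,
     Braid = mor_braid \<sigma> \<omega> \<delta> q \<alpha>,
     Twist = mor_twist \<sigma> \<beta> \<rparr>"


section \<open>Simple objects and direct sums in the equivariantisation\<close>

type_synonym 's eobj = "'s obj \<times> 's mor"

definition obj_leaves :: "'s set \<Rightarrow> 's obj" where
  "obj_leaves S = Obj (Leaf ` S) (\<lambda>k. case k of Leaf u \<Rightarrow> u | _ \<Rightarrow> undefined)"

definition X_obj :: "'g::ab_group_add \<Rightarrow> complex \<Rightarrow> 'g simple eobj" where
  "X_obj a s = (obj_leaves {SC a}, \<lambda>j i. s * mor_id (obj_leaves {SC a}) j i)"

text \<open>\<open>Y_obj {b, - b}\<close> is \<open>\<C>\<^sub>b \<oplus> \<C>\<^bsub>-b\<^esub>\<close> with the interchange of the summands; it is used for \<open>b \<noteq> - b\<close>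
  only. In \<open>g\<^sub>*\<close> of this object the summand \<open>Leaf (SC b)\<close> has label \<open>SC (- b)\<close>.\<close>

definition Y_obj :: "'g::ab_group_add set \<Rightarrow> 'g simple eobj" where
  "Y_obj P = (obj_leaves (SC ` P),
     \<lambda>j i. if \<exists>b\<in>P. i = Leaf (SC b) \<and> j = Leaf (SC (- b)) then 1 else 0)"

definition Z_obj :: "'g::ab_group_add mod2 \<Rightarrow> complex \<Rightarrow> 'g simple eobj" where
  "Z_obj x r = (obj_leaves {SX x}, \<lambda>j i. r * mor_id (obj_leaves {SX x}) j i)"

definition dsum :: "'s eobj \<Rightarrow> 's eobj \<Rightarrow> 's eobj" (infixr "\<oplus>" 65) where
  "dsum P R =
     (Obj (InL ` summands (fst P) \<union> InR ` summands (fst R))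
        (\<lambda>k. case k of InL i \<Rightarrow> label (fst P) i | InR i \<Rightarrow> label (fst R) i | _ \<Rightarrow> undefined),
      \<lambda>k' k. case (k', k) of (InL i', InL i) \<Rightarrow> snd P i' i | (InR i', InR i) \<Rightarrow> snd R i' i | _ \<Rightarrow> 0)"

definition Dsum :: "'g::ab_group_add set \<Rightarrow> ('g \<Rightarrow> 'g simple eobj) \<Rightarrow> 'g simple eobj" where
  "Dsum S F =
     (Obj {At (SC t) i | t i. t \<in> S \<and> i \<in> summands (fst (F t))}
        (\<lambda>k. case k of At (SC t) i \<Rightarrow> label (fst (F t)) i | _ \<Rightarrow> undefined),
      \<lambda>k' k. case (k', k) of
        (At (SC t') i', At (SC t) i) \<Rightarrow> if t' = t \<and> t \<in> S then snd (F t) i' i else 0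
      | _ \<Rightarrow> 0)"

end

theory Submission
  imports Defs
begin

text \<open>All objects in the fusion rules carry a monomial equivariant structure: \<open>\<phi>\<^sub>g\<close> permutes the
  simple summands by an involution, up to scalars. The simple summands of \<open>P \<otimes> R\<close> are permuted
  orbitwise, with the tensor structure \<open>\<tau>\<^sup>g\<close> contributing a sign. A fixed summand gives an \<open>X\<close> or \<open>Z\<close>
  whose sign is read off. On an orbit of size two the scalars are normalised to \<open>1\<close> by rescaling one
  of the two summands; the result is a \<open>Y\<close> if the labels of the two summands differ, and splits into
  the \<open>\<plusminus>1\<close>-eigenspaces of the interchange if they agree. Finally, \<open>B\<^sub>Q = \<sigma>\<^sup>2\<close> and \<open>\<omega> = \<plusminus>1\<close> give
  \<open>\<omega>(x, a, -a) = B\<^sub>Q(x, a)\<close> whenever \<open>2a = 0\<close>.\<close>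

section \<open>Block matrices and the summands of the simple objects\<close>

text \<open>Composition depends only on the summands of the middle object, and these are the same
  for \<open>A\<close> and \<open>obj_act A\<close>. Recording just this set puts equivariant
  structures, which start at \<open>obj_act A\<close>, into the same matrix calculus as all other
  morphisms.\<close>

definition comp_over :: "'s summand set \<Rightarrow> 's mor \<Rightarrow> 's mor \<Rightarrow> 's mor" where
  "comp_over S g f = (\<lambda>k i. \<Sum>j\<in>S. g k j * f j i)"

text \<open>The part of \<open>mor_hom\<close> that ignores labels; it is what the identity laws
  below rest on.\<close>

definition supported :: "'s summand set \<Rightarrow> 's summand set \<Rightarrow> 's mor \<Rightarrow> bool" where
  "supported S T f \<longleftrightarrow> (\<forall>j i. f j i \<noteq> 0 \<longrightarrow> i \<in> S \<and> j \<in> T)"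

definition mat_id :: "'s summand set \<Rightarrow> 's mor" where
  "mat_id S = (\<lambda>j i. if i \<in> S \<and> j = i then 1 else 0)"

lemma mor_comp_eq: "mor_comp A B D = comp_over (summands B)"
  by (intro ext) (simp add: mor_comp_def comp_over_def)

lemma mor_id_eq: "mor_id A = mat_id (summands A)"
  by (intro ext) (simp add: mor_id_def mat_id_def)

lemma comp_over_assoc: "comp_over S h (comp_over T g f) = comp_over T (comp_over S h g) f"
proof (intro ext)
  fix k i
  have "comp_over S h (comp_over T g f) k i = (\<Sum>j\<in>S. \<Sum>l\<in>T. h k j * (g j l * f l i))"
    by (simp add: comp_over_def sum_distrib_left)
  also have "\<dots> = (\<Sum>l\<in>T. \<Sum>j\<in>S. h k j * (g j l * f l i))" by (rule sum.swap)
  also have "\<dots> = comp_over T (comp_over S h g) f k i"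
    by (simp add: comp_over_def sum_distrib_right mult.assoc)
  finally show "comp_over S h (comp_over T g f) k i = comp_over T (comp_over S h g) f k i" .
qed

lemma comp_over_id_left:
  assumes "finite T" "supported S T f"
  shows "comp_over T (mat_id T) f = f"
proof (intro ext)
  fix k i
  have "comp_over T (mat_id T) f k i = (\<Sum>j\<in>T. if j = k then f k i else 0)"
    unfolding comp_over_def by (rule sum.cong) (auto simp: mat_id_def)
  then show "comp_over T (mat_id T) f k i = f k i"
    using assms by (auto simp: supported_def)
qed

lemma comp_over_id_right:
  assumes "finite S" "supported S T f"
  shows "comp_over S f (mat_id S) = f"
proof (intro ext)
  fix k i
  have "comp_over S f (mat_id S) k i = (\<Sum>j\<in>S. if j = i then f k i else 0)"
    unfolding comp_over_def by (rule sum.cong) (auto simp: mat_id_def)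
  then show "comp_over S f (mat_id S) k i = f k i"
    using assms by (auto simp: supported_def)
qed

lemma comp_over_nonzero:
  assumes "comp_over S g f k i \<noteq> 0"
  obtains j where "j \<in> S" "g k j \<noteq> 0" "f j i \<noteq> 0"
proof -
  have "\<exists>j\<in>S. g k j * f j i \<noteq> 0"
    using assms unfolding comp_over_def by (meson sum.neutral)
  then show ?thesis using that by auto
qed

lemma mor_hom_supported: "f \<in> mor_hom A B \<Longrightarrow> supported (summands A) (summands B) f"
  by (auto simp: mor_hom_def supported_def)

lemma mor_hom_comp:
  assumes "f \<in> mor_hom A B" "g \<in> mor_hom B D"
  shows "comp_over (summands B) g f \<in> mor_hom A D"
proof -
  have "i \<in> summands A \<and> k \<in> summands D \<and> label A i = label D k"
    if nz: "comp_over (summands B) g f k i \<noteq> 0" for k i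
  proof -
    obtain j where "g k j \<noteq> 0" "f j i \<noteq> 0" using comp_over_nonzero[OF nz] by blast
    then show ?thesis using assms unfolding mor_hom_def by force
  qed
  then show ?thesis by (simp add: mor_hom_def)
qed

section \<open>The action on labels and the basic equivariant objects\<close>

lemma summands_obj_act [simp]: "summands (obj_act A) = summands A"
  by (simp add: obj_act_def)

lemma label_obj_act [simp]: "label (obj_act A) i = simple_act (label A i)"
  by (simp add: obj_act_def)

lemma simple_act_invol [simp]: "simple_act (simple_act u) = u"
  by (cases u) auto

lemma cls_uminus [simp]: "cls (- a) = cls a"
proof -
  have "- a - a = - a + - a" by simp
  then show ?thesis unfolding cls_eq_iff by blast
qed

text \<open>Negation does not change the class modulo doubles, so \<tau> sends each summand of a
  product to a summand of the product of the images.\<close>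

lemma simple_act_tensor:
  "u \<in> simple_tensor \<delta> v w \<Longrightarrow> simple_act u \<in> simple_tensor \<delta> (simple_act v) (simple_act w)"
  by (cases v; cases w) auto

text \<open>\<open>X_obj\<close> and \<open>Z_obj\<close> in one form, so that arguments common to
  both are made once. It is an equivariant object only for \<open>u\<close> fixed by the action; for
  other \<open>u\<close> just its underlying object serves, in \<open>swap_eobj\<close>.\<close>

definition simple_eobj :: "'g::ab_group_add simple \<Rightarrow> complex \<Rightarrow> 'g simple eobj" where
  "simple_eobj u s = (obj_leaves {u}, \<lambda>j i. if i = Leaf u \<and> j = Leaf u then s else 0)"

lemma X_obj_eq: "X_obj a s = simple_eobj (SC a) s"
  unfolding X_obj_def simple_eobj_def by (auto simp: mor_id_def obj_leaves_def fun_eq_iff)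

lemma Z_obj_eq: "Z_obj x s = simple_eobj (SX x) s"
  unfolding Z_obj_def simple_eobj_def by (auto simp: mor_id_def obj_leaves_def fun_eq_iff)

text \<open>The free equivariant object on a simple object; it stays a single orbit of summands even if
  \<open>u\<close> is fixed by the action.\<close>

definition swap_eobj :: "'g::ab_group_add simple \<Rightarrow> 'g simple eobj" where
  "swap_eobj u = (fst (simple_eobj u 1 \<oplus> simple_eobj (simple_act u) 1),
     \<lambda>j i. if (i = InL (Leaf u) \<and> j = InR (Leaf (simple_act u))) \<or>
              (j = InL (Leaf u) \<and> i = InR (Leaf (simple_act u))) then 1 else 0)"

lemma simple_eobj_simps [simp]:
  "summands (fst (simple_eobj u s)) = {Leaf u}"
  "label (fst (simple_eobj u s)) (Leaf v) = v"
  "snd (simple_eobj u s) = (\<lambda>j i. if i = Leaf u \<and> j = Leaf u then s else 0)"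
  by (simp_all add: simple_eobj_def obj_leaves_def)

lemma Y_obj_simps [simp]:
  "summands (fst (Y_obj P)) = Leaf ` SC ` P"
  "label (fst (Y_obj P)) (Leaf v) = v"
  "snd (Y_obj P) = (\<lambda>j i. if \<exists>b\<in>P. i = Leaf (SC b) \<and> j = Leaf (SC (- b)) then 1 else 0)"
  by (simp_all add: Y_obj_def obj_leaves_def)

lemma dsum_simps [simp]:
  "summands (fst (P \<oplus> R)) = InL ` summands (fst P) \<union> InR ` summands (fst R)"
  "label (fst (P \<oplus> R)) (InL i) = label (fst P) i"
  "label (fst (P \<oplus> R)) (InR j) = label (fst R) j"
  by (simp_all add: dsum_def)

section \<open>Block diagonal matrices for direct sums\<close>

definition block_mor :: "'s mor \<Rightarrow> 's mor \<Rightarrow> 's mor" where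
  "block_mor f h = (\<lambda>k' k. case (k', k) of
     (InL i', InL i) \<Rightarrow> f i' i | (InR i', InR i) \<Rightarrow> h i' i | _ \<Rightarrow> 0)"

lemma snd_dsum: "snd (P \<oplus> R) = block_mor (snd P) (snd R)"
  by (simp add: dsum_def block_mor_def)

lemma block_mor_simps [simp]:
  "block_mor f h (InL i) (InL j) = f i j" "block_mor f h (InR i) (InR j) = h i j"
  "block_mor f h (InL i) (InR j) = 0" "block_mor f h (InR i) (InL j) = 0"
  by (simp_all add: block_mor_def)

lemma block_mor_nonzero:
  assumes "block_mor f h k' k \<noteq> 0"
  obtains (L) i' i where "k' = InL i'" "k = InL i" "f i' i \<noteq> 0"
    | (R) i' i where "k' = InR i'" "k = InR i" "h i' i \<noteq> 0"
  using assms by (cases k'; cases k) (auto simp: block_mor_def)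

lemma sum_InL_InR:
  assumes "finite S" "finite T"
  shows "(\<Sum>k\<in>InL ` S \<union> InR ` T. F k) = (\<Sum>i\<in>S. F (InL i)) + (\<Sum>i\<in>T. F (InR i))"
  using assms by (subst sum.union_disjoint) (auto simp: sum.reindex inj_on_def)

lemma comp_over_block:
  assumes "finite S" "finite T"
  shows "comp_over (InL ` S \<union> InR ` T) (block_mor g g') (block_mor f f')
    = block_mor (comp_over S g f) (comp_over T g' f')"
proof (intro ext)
  fix k i
  show "comp_over (InL ` S \<union> InR ` T) (block_mor g g') (block_mor f f') k i
    = block_mor (comp_over S g f) (comp_over T g' f') k i"
    unfolding comp_over_def sum_InL_InR[OF assms]
    by (cases k; cases i) (simp_all add: block_mor_def)
qed

lemma block_mor_id: "block_mor (mat_id S) (mat_id T) = mat_id (InL ` S \<union> InR ` T)"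
proof (intro ext)
  fix k i
  show "block_mor (mat_id S) (mat_id T) k i = mat_id (InL ` S \<union> InR ` T) k i"
    by (cases k; cases i) (auto simp: block_mor_def mat_id_def)
qed

lemma block_mor_hom:
  assumes "f \<in> mor_hom (fst P) (fst P')" "h \<in> mor_hom (fst R) (fst R')"
  shows "block_mor f h \<in> mor_hom (fst (P \<oplus> R)) (fst (P' \<oplus> R'))"
proof -
  have "i \<in> summands (fst (P \<oplus> R)) \<and> j \<in> summands (fst (P' \<oplus> R')) \<and>
      label (fst (P \<oplus> R)) i = label (fst (P' \<oplus> R')) j"
    if "block_mor f h j i \<noteq> 0" for j i
    using that
  proof (cases rule: block_mor_nonzero)
    case L then show ?thesis using assms(1) by (auto simp: mor_hom_def)
  next
    case R then show ?thesis using assms(2) by (auto simp: mor_hom_def)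
  qed
  then show ?thesis unfolding mor_hom_def by blast
qed

section \<open>Isomorphisms in the equivariantisation\<close>

context crossed_input
begin

abbreviation E :: "('g simple eobj, 'g simple mor) tensor_cat" where
  "E \<equiv> equivariantisation (crossed_category \<sigma> \<omega> \<delta> q \<epsilon> \<alpha> \<beta>)"

text \<open>As \<open>g_*\<close> is the identity on matrices, the equivariance condition says that
  the structure matrix squares to the identity. Such a matrix is its own inverse.\<close>

lemma Ob_E_iff: "P \<in> Ob E \<longleftrightarrow> finite (summands (fst P)) \<and>
    snd P \<in> mor_hom (obj_act (fst P)) (fst P) \<and>
    comp_over (summands (fst P)) (snd P) (snd P) = mat_id (summands (fst P))" (is "_ \<longleftrightarrow> ?R")
proof
  assume "P \<in> Ob E" then show ?R
    by (auto simp: equivariantisation_def crossed_category_def inverse_morphisms_def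
      mor_comp_eq mor_id_eq mor_act_def)
next
  assume R: ?R
  \<comment> \<open>The inverse has to go from \<open>fst P\<close> to
    \<open>obj_act (fst P)\<close>; the same matrix qualifies because the action on labels is an
    involution.\<close>
  have "label (fst P) i = simple_act (label (fst P) j)" if "snd P j i \<noteq> 0" for j i
  proof -
    have "simple_act (label (fst P) i) = label (fst P) j"
      using R that by (auto simp: mor_hom_def)
    then show ?thesis by (metis simple_act_invol)
  qed
  with R have "snd P \<in> mor_hom (fst P) (obj_act (fst P))"
    by (auto simp: mor_hom_def)
  with R show "P \<in> Ob E"
    by (auto simp: equivariantisation_def crossed_category_def inverse_morphisms_def
      mor_comp_eq mor_id_eq mor_act_def split: prod.splits intro!: exI[of _ "snd P"])
qed

lemma isomorphic_E_iff: "P \<cong>\<^bsub>E\<^esub> R \<longleftrightarrow> P \<in> Ob E \<and> R \<in> Ob E \<and>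
    (\<exists>f h. f \<in> mor_hom (fst P) (fst R) \<and> h \<in> mor_hom (fst R) (fst P) \<and>
      comp_over (summands (fst R)) h f = mat_id (summands (fst P)) \<and>
      comp_over (summands (fst P)) f h = mat_id (summands (fst R)) \<and>
      comp_over (summands (fst R)) (snd R) f = comp_over (summands (fst P)) f (snd P))"
    (is "_ \<longleftrightarrow> _ \<and> _ \<and> ?ex")
proof -
  have "(\<exists>f h. inverse_morphisms E P R f h) \<longleftrightarrow> ?ex" if P: "P \<in> Ob E" and R: "R \<in> Ob E"
  proof
    assume "\<exists>f h. inverse_morphisms E P R f h"
    then show ?ex
      by (auto simp: inverse_morphisms_def equivariantisation_def crossed_category_def
        mor_comp_eq mor_id_eq mor_act_def split: prod.splits)
  next
    let ?A = "summands (fst P)" and ?B = "summands (fst R)"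
    assume ?ex
    then obtain f h where fh: "f \<in> mor_hom (fst P) (fst R)" "h \<in> mor_hom (fst R) (fst P)"
      "comp_over ?B h f = mat_id ?A" "comp_over ?A f h = mat_id ?B"
      "comp_over ?B (snd R) f = comp_over ?A f (snd P)" by blast
    have fin: "finite ?A" "finite ?B" and sup: "supported ?A ?A (snd P)" "supported ?B ?B (snd R)"
      using P R by (auto simp: Ob_E_iff dest!: mor_hom_supported)
    \<comment> \<open>Equivariance of \<open>h\<close> follows from that of \<open>f\<close>: insert
      \<open>h f = 1\<close> before \<open>snd P\<close>, move \<open>f\<close> past it, then cancel
      \<open>f h = 1\<close>.\<close>
    have "comp_over ?A (snd P) h = comp_over ?A (comp_over ?A (comp_over ?B h f) (snd P)) h"
      using fin sup fh(3) by (simp add: comp_over_id_left)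
    also have "\<dots> = comp_over ?B h (comp_over ?B (snd R) (comp_over ?A f h))"
      by (simp add: comp_over_assoc fh(5)[symmetric])
        (simp add: comp_over_assoc[symmetric] fh(5))
    also have "\<dots> = comp_over ?B h (snd R)"
      using fin sup fh(4) by (simp add: comp_over_id_right)
    finally have "inverse_morphisms E P R f h"
      using fh
      by (auto simp: inverse_morphisms_def equivariantisation_def crossed_category_def
        mor_comp_eq mor_id_eq mor_act_def split: prod.splits)
    then show "\<exists>f h. inverse_morphisms E P R f h" by blast
  qed
  then show ?thesis unfolding isomorphic_def by blast
qed

lemma iso_trans:
  assumes "P \<cong>\<^bsub>E\<^esub> R" "R \<cong>\<^bsub>E\<^esub> S"
  shows "P \<cong>\<^bsub>E\<^esub> S"
proof -
  let ?A = "summands (fst P)" and ?B = "summands (fst R)" and ?C = "summands (fst S)"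
  obtain f h where fh: "f \<in> mor_hom (fst P) (fst R)" "h \<in> mor_hom (fst R) (fst P)"
      "comp_over ?B h f = mat_id ?A" "comp_over ?A f h = mat_id ?B"
      "comp_over ?B (snd R) f = comp_over ?A f (snd P)"
    using assms(1) unfolding isomorphic_E_iff by blast
  obtain f' h' where fh': "f' \<in> mor_hom (fst R) (fst S)" "h' \<in> mor_hom (fst S) (fst R)"
      "comp_over ?C h' f' = mat_id ?B" "comp_over ?B f' h' = mat_id ?C"
      "comp_over ?C (snd S) f' = comp_over ?B f' (snd R)"
    using assms(2) unfolding isomorphic_E_iff by blast
  have fin: "finite ?A" "finite ?B" "finite ?C"
    using assms by (auto simp: isomorphic_E_iff Ob_E_iff)
  have "comp_over ?C (comp_over ?B h h') (comp_over ?B f' f)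
      = comp_over ?B h (comp_over ?B (comp_over ?C h' f') f)"
    by (simp add: comp_over_assoc)
  also have "\<dots> = mat_id ?A"
    by (simp add: fh'(3) comp_over_id_left[OF fin(2) mor_hom_supported[OF fh(1)]] fh(3))
  finally have 1: "comp_over ?C (comp_over ?B h h') (comp_over ?B f' f) = mat_id ?A" .
  have "comp_over ?A (comp_over ?B f' f) (comp_over ?B h h')
      = comp_over ?B f' (comp_over ?B (comp_over ?A f h) h')"
    by (simp add: comp_over_assoc)
  also have "\<dots> = mat_id ?C"
    by (simp add: fh(4) comp_over_id_left[OF fin(2) mor_hom_supported[OF fh'(2)]] fh'(4))
  finally have 2: "comp_over ?A (comp_over ?B f' f) (comp_over ?B h h') = mat_id ?C" .
  have 3: "comp_over ?C (snd S) (comp_over ?B f' f) = comp_over ?A (comp_over ?B f' f) (snd P)"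
    by (simp add: comp_over_assoc fh'(5)) (simp add: comp_over_assoc[symmetric] fh(5))
  have "P \<in> Ob E" "S \<in> Ob E" using assms by (auto simp: isomorphic_def)
  then show ?thesis
    unfolding isomorphic_E_iff
    using 1 2 3 mor_hom_comp[OF fh(1) fh'(1)] mor_hom_comp[OF fh'(2) fh(2)] by blast
qed

text \<open>The isomorphism is the monomial matrix sending summand \<open>i\<close> to
  \<open>g i\<close> with factor \<open>c i\<close>; \<open>equi\<close> is its equivariance, entry
  by entry. That \<open>P\<close> is an object is obtained by transporting the structure of
  \<open>R\<close> back along it.\<close>

lemma iso_relabel:
  assumes R: "R \<in> Ob E" and bij: "bij_betw g (summands (fst P)) (summands (fst R))"
    and lab: "\<And>i. i \<in> summands (fst P) \<Longrightarrow> label (fst R) (g i) = label (fst P) i"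
    and scale: "\<And>i. i \<in> summands (fst P) \<Longrightarrow> c i \<noteq> 0"
    and sup: "supported (summands (fst P)) (summands (fst P)) (snd P)"
    and equi: "\<And>i j. i \<in> summands (fst P) \<Longrightarrow> j \<in> summands (fst P) \<Longrightarrow>
      snd R (g j) (g i) * c i = c j * snd P j i"
  shows "P \<cong>\<^bsub>E\<^esub> R"
proof -
  let ?A = "summands (fst P)" and ?B = "summands (fst R)"
  define f where "f = (\<lambda>j i. if i \<in> ?A \<and> j = g i then c i else 0)"
  define h where "h = (\<lambda>i j. if i \<in> ?A \<and> j = g i then inverse (c i) else 0)"
  have finB: "finite ?B" and homR: "snd R \<in> mor_hom (obj_act (fst R)) (fst R)"
    and sqR: "comp_over ?B (snd R) (snd R) = mat_id ?B" using R by (auto simp: Ob_E_iff)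
  have finA: "finite ?A" using bij finB bij_betw_finite by blast
  have inj: "inj_on g ?A" and img: "g ` ?A = ?B" using bij by (auto simp: bij_betw_def)
  have gB: "g i \<in> ?B" if "i \<in> ?A" for i using that img by blast
  have sumB: "(\<Sum>j\<in>?B. F j) = (\<Sum>j\<in>?A. F (g j))" for F :: "'g simple summand \<Rightarrow> complex"
    using sum.reindex[OF inj, of F] img by (simp add: comp_def)
  have fg: "f (g j) i = (if i \<in> ?A \<and> j = i then c i else 0)" if "j \<in> ?A" for i j
    using inj that by (auto simp: f_def inj_on_def)
  have hg: "h i (g j) = (if j = i then inverse (c i) else 0)" if "j \<in> ?A" for i j
    using inj that by (auto simp: h_def inj_on_def)
  have hf: "comp_over ?B h f = mat_id ?A"
  proof (intro ext)
    fix k i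
    have "comp_over ?B h f k i = (\<Sum>j\<in>?A. if j = k then (if i \<in> ?A \<and> k = i then 1 else 0) else 0)"
      unfolding comp_over_def sumB
      by (rule sum.cong) (auto simp: fg hg scale)
    also have "\<dots> = mat_id ?A k i" using finA by (auto simp: mat_id_def)
    finally show "comp_over ?B h f k i = mat_id ?A k i" .
  qed
  have fh: "comp_over ?A f h = mat_id ?B"
  proof (intro ext)
    fix k i
    show "comp_over ?A f h k i = mat_id ?B k i"
    proof (cases "i \<in> ?B")
      case False
      then have "h j i = 0" for j using gB by (auto simp: h_def)
      with False show ?thesis by (simp add: comp_over_def mat_id_def)
    next
      case True
      then obtain l where l: "l \<in> ?A" "i = g l" using img by blast
      have "comp_over ?A f h k i = (\<Sum>j\<in>?A. if j = l then (if k = i then 1 else 0) else 0)"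
        unfolding comp_over_def l(2)
        by (rule sum.cong) (auto simp: hg l(1) scale f_def)
      also have "\<dots> = mat_id ?B k i" using finA l True by (auto simp: mat_id_def)
      finally show ?thesis .
    qed
  qed
  have fhom: "f \<in> mor_hom (fst P) (fst R)"
    by (auto simp: mor_hom_def f_def lab gB split: if_splits)
  have hhom: "h \<in> mor_hom (fst R) (fst P)"
    by (auto simp: mor_hom_def h_def lab gB split: if_splits)
  have eq: "comp_over ?B (snd R) f = comp_over ?A f (snd P)"
  proof (intro ext)
    fix k i
    have L: "comp_over ?B (snd R) f k i = (\<Sum>j\<in>?A. if j = i then snd R k (g i) * c i else 0)"
      unfolding comp_over_def sumB by (rule sum.cong) (auto simp: fg)
    show "comp_over ?B (snd R) f k i = comp_over ?A f (snd P) k i"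
    proof (cases "k \<in> ?B")
      case False
      then have "f k j = 0" "snd R k j = 0" for j
        using gB homR by (auto simp: f_def mor_hom_def)
      then show ?thesis by (simp add: comp_over_def)
    next
      case True
      then obtain l where l: "l \<in> ?A" "k = g l" using img by blast
      have "comp_over ?A f (snd P) k i = (\<Sum>j\<in>?A. if j = l then c l * snd P l i else 0)"
        unfolding comp_over_def l(2) by (rule sum.cong) (auto simp: fg l(1))
      then show ?thesis
        using L finA l equi[of i l] sup by (auto simp: supported_def)
    qed
  qed
  \<comment> \<open>A nonzero entry of \<open>snd P\<close> forces a nonzero entry of
    \<open>snd R\<close> through \<open>equi\<close>, as the factors \<open>c\<close> are nonzero;
    the label condition is then read off in \<open>R\<close>.\<close>
  have homP: "snd P \<in> mor_hom (obj_act (fst P)) (fst P)"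
  proof -
    have "simple_act (label (fst P) i) = label (fst P) j" if nz: "snd P j i \<noteq> 0" for j i
    proof -
      have ij: "i \<in> ?A" "j \<in> ?A" using sup nz by (auto simp: supported_def)
      then have "snd R (g j) (g i) \<noteq> 0" using equi[OF ij] scale nz by force
      then have "simple_act (label (fst R) (g i)) = label (fst R) (g j)"
        using homR by (auto simp: mor_hom_def)
      then show ?thesis using lab ij by simp
    qed
    then show ?thesis using sup by (auto simp: mor_hom_def supported_def)
  qed
  have "snd P = comp_over ?A (comp_over ?B h f) (snd P)"
    using finA sup by (simp add: hf comp_over_id_left)
  also have "\<dots> = comp_over ?B h (comp_over ?B (snd R) f)"
    by (simp add: eq comp_over_assoc)
  finally have P_eq: "snd P = comp_over ?B h (comp_over ?B (snd R) f)" .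
  \<comment> \<open>By \<open>P_eq\<close> both factors are conjugates of \<open>snd R\<close>. The
    inner \<open>f h\<close> cancels, \<open>snd R\<close> squares to the identity, and
    \<open>h f = 1\<close> remains.\<close>
  have "comp_over ?A (snd P) (snd P) = comp_over ?B h (comp_over ?B (snd R)
      (comp_over ?B (comp_over ?A f h) (comp_over ?B (snd R) f)))"
    by (subst (1 2) P_eq) (simp add: comp_over_assoc)
  also have "comp_over ?B (comp_over ?A f h) (comp_over ?B (snd R) f) = comp_over ?B (snd R) f"
    using finB mor_hom_supported[OF homR] by (simp add: fh comp_over_assoc comp_over_id_left)
  also have "comp_over ?B (snd R) (comp_over ?B (snd R) f) = f"
    by (simp add: comp_over_assoc sqR comp_over_id_left[OF finB mor_hom_supported[OF fhom]])
  finally have "comp_over ?A (snd P) (snd P) = mat_id ?A" by (simp add: hf)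
  then have "P \<in> Ob E" using finA homP by (simp add: Ob_E_iff)
  then show ?thesis
    unfolding isomorphic_E_iff using R fhom hhom hf fh eq by blast
qed

lemma iso_refl: "P \<in> Ob E \<Longrightarrow> P \<cong>\<^bsub>E\<^esub> P"
  by (rule iso_relabel[where g = id and c = "\<lambda>_. 1"])
    (auto simp: Ob_E_iff mor_hom_def supported_def)

section \<open>Direct sums in the equivariantisation\<close>

lemma dsum_Ob:
  assumes "P \<in> Ob E" "R \<in> Ob E"
  shows "P \<oplus> R \<in> Ob E"
proof -
  have "snd (P \<oplus> R) \<in> mor_hom (obj_act (fst (P \<oplus> R))) (fst (P \<oplus> R))"
    using assms unfolding Ob_E_iff snd_dsum mor_hom_def
    by (auto elim!: block_mor_nonzero)
  then show ?thesis
    using assms by (auto simp: Ob_E_iff snd_dsum comp_over_block block_mor_id)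
qed

lemma dsum_cong:
  assumes "P \<cong>\<^bsub>E\<^esub> P'" "R \<cong>\<^bsub>E\<^esub> R'"
  shows "P \<oplus> R \<cong>\<^bsub>E\<^esub> P' \<oplus> R'"
proof -
  obtain f h where fh: "f \<in> mor_hom (fst P) (fst P')" "h \<in> mor_hom (fst P') (fst P)"
      "comp_over (summands (fst P')) h f = mat_id (summands (fst P))"
      "comp_over (summands (fst P)) f h = mat_id (summands (fst P'))"
      "comp_over (summands (fst P')) (snd P') f = comp_over (summands (fst P)) f (snd P)"
    using assms(1) unfolding isomorphic_E_iff by blast
  obtain f' h' where fh': "f' \<in> mor_hom (fst R) (fst R')" "h' \<in> mor_hom (fst R') (fst R)"
      "comp_over (summands (fst R')) h' f' = mat_id (summands (fst R))"
      "comp_over (summands (fst R)) f' h' = mat_id (summands (fst R'))"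
      "comp_over (summands (fst R')) (snd R') f' = comp_over (summands (fst R)) f' (snd R)"
    using assms(2) unfolding isomorphic_E_iff by blast
  have ob: "P \<in> Ob E" "P' \<in> Ob E" "R \<in> Ob E" "R' \<in> Ob E"
    using assms by (auto simp: isomorphic_def)
  then have fin: "finite (summands (fst P))" "finite (summands (fst P'))"
      "finite (summands (fst R))" "finite (summands (fst R'))"
    by (auto simp: Ob_E_iff)
  show ?thesis
    unfolding isomorphic_E_iff using fh fh' ob fin
    by (intro conjI exI[of _ "block_mor f f'"] exI[of _ "block_mor h h'"] dsum_Ob block_mor_hom)
      (simp_all add: snd_dsum comp_over_block block_mor_id)
qed

text \<open>Needed because \<open>\<oplus>\<close> associates to the right, whereas a product of two
  \<open>Y\<close> splits into two orbits each of which may split again, giving a bracketed sum of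
  sums.\<close>

lemma dsum_assoc:
  assumes "P \<in> Ob E" "R \<in> Ob E" "S \<in> Ob E"
  shows "(P \<oplus> R) \<oplus> S \<cong>\<^bsub>E\<^esub> P \<oplus> R \<oplus> S"
proof (rule iso_relabel[where c = "\<lambda>_. 1" and
    g = "\<lambda>k. case k of InL (InL i) \<Rightarrow> InL i | InL (InR i) \<Rightarrow> InR (InL i) | InR i \<Rightarrow> InR (InR i)"])
  show "P \<oplus> R \<oplus> S \<in> Ob E" using assms by (intro dsum_Ob)
  have "(P \<oplus> R) \<oplus> S \<in> Ob E" using assms by (intro dsum_Ob)
  then show "supported (summands (fst ((P \<oplus> R) \<oplus> S))) (summands (fst ((P \<oplus> R) \<oplus> S)))
      (snd ((P \<oplus> R) \<oplus> S))"
    unfolding Ob_E_iff by (auto dest!: mor_hom_supported)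
qed (auto simp: bij_betw_def inj_on_def snd_dsum image_Un image_image)

text \<open>The structure matrix is block diagonal with one block for each index \<open>t\<close>,
  so its square can be computed block by block.\<close>

lemma Dsum_Ob:
  assumes "\<And>t. t \<in> S \<Longrightarrow> F t \<in> Ob E"
  shows "Dsum S F \<in> Ob E"
proof -
  let ?N = "summands (fst (Dsum S F))"
  have N: "?N = (\<Union>t\<in>S. At (SC t) ` summands (fst (F t)))" by (auto simp: Dsum_def)
  have fin: "finite (summands (fst (F t)))" if "t \<in> S" for t
    using assms that by (auto simp: Ob_E_iff)
  have finN: "finite ?N" unfolding N using fin by (intro finite_UN_I finite_imageI) auto
  have nz: "\<exists>t i i'. t \<in> S \<and> k = At (SC t) i \<and> k' = At (SC t) i' \<and> snd (F t) i' i \<noteq> 0"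
    if "snd (Dsum S F) k' k \<noteq> 0" for k' k
    using that by (auto simp: Dsum_def split: summand.splits graded_simple.splits if_splits)
  have hom: "snd (Dsum S F) \<in> mor_hom (obj_act (fst (Dsum S F))) (fst (Dsum S F))"
  proof -
    have "i \<in> ?N \<and> j \<in> ?N \<and> simple_act (label (fst (Dsum S F)) i) = label (fst (Dsum S F)) j"
      if nz': "snd (Dsum S F) j i \<noteq> 0" for j i
    proof -
      obtain t k l where t: "t \<in> S" "i = At (SC t) k" "j = At (SC t) l" "snd (F t) l k \<noteq> 0"
        using nz[OF nz'] by blast
      then show ?thesis
        using assms[OF t(1)] by (auto simp: Ob_E_iff mor_hom_def Dsum_def)
    qed
    then show ?thesis by (simp add: mor_hom_def)
  qed
  have "comp_over ?N (snd (Dsum S F)) (snd (Dsum S F)) = mat_id ?N"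
  proof (intro ext)
    fix k i
    show "comp_over ?N (snd (Dsum S F)) (snd (Dsum S F)) k i = mat_id ?N k i"
    proof (cases "i \<in> ?N")
      case False
      then have "snd (Dsum S F) j i = 0" for j
        using hom by (auto simp: mor_hom_def)
      with False show ?thesis by (simp add: comp_over_def mat_id_def)
    next
      case True
      then obtain t l where t: "t \<in> S" "i = At (SC t) l" "l \<in> summands (fst (F t))"
        by (auto simp: N)
      let ?T = "summands (fst (F t))"
      \<comment> \<open>The column \<open>i\<close> lies in the block of \<open>t\<close>, so only
        indices \<open>j\<close> of that block contribute.\<close>
      have "comp_over ?N (snd (Dsum S F)) (snd (Dsum S F)) k i
          = (\<Sum>j\<in>At (SC t) ` ?T. snd (Dsum S F) k j * snd (Dsum S F) j i)"
        unfolding comp_over_def using finN nz t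
        by (intro sum.mono_neutral_right) (fastforce simp: N)+
      also have "\<dots> = (\<Sum>j\<in>?T. snd (Dsum S F) k (At (SC t) j) * snd (F t) j l)"
        using t by (subst sum.reindex) (auto simp: inj_on_def Dsum_def)
      also have "\<dots> = mat_id ?N k i"
      proof (cases "\<exists>m. k = At (SC t) m")
        case True
        then obtain m where m: "k = At (SC t) m" by blast
        have "(\<Sum>j\<in>?T. snd (Dsum S F) k (At (SC t) j) * snd (F t) j l)
            = comp_over ?T (snd (F t)) (snd (F t)) m l"
          using t by (simp add: m Dsum_def comp_over_def)
        also have "\<dots> = mat_id ?T m l" using assms[OF t(1)] by (simp add: Ob_E_iff)
        finally show ?thesis using t by (auto simp: m mat_id_def N)
      next
        case False
        then have "snd (Dsum S F) k (At (SC t) j) = 0" for j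
          using nz by fastforce
        moreover have "k \<noteq> i" using False t by blast
        ultimately show ?thesis by (simp add: mat_id_def)
      qed
      finally show ?thesis .
    qed
  qed
  then show ?thesis using finN hom by (simp add: Ob_E_iff)
qed

section \<open>Objects on one summand or on one orbit\<close>

lemma simple_eobj_Ob:
  assumes "simple_act u = u" "s \<in> {1, -1}"
  shows "simple_eobj u s \<in> Ob E"
proof -
  let ?P = "simple_eobj u s"
  have "snd ?P \<in> mor_hom (obj_act (fst ?P)) (fst ?P)"
    using assms(1) by (simp add: mor_hom_def)
  moreover have "s * s = 1" using assms(2) by auto
  then have "comp_over (summands (fst ?P)) (snd ?P) (snd ?P) = mat_id (summands (fst ?P))"
    by (intro ext) (simp add: comp_over_def mat_id_def)
  ultimately show ?thesis by (simp add: Ob_E_iff)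
qed

text \<open>Stated for any set closed under negation, so that it covers
  \<open>{a + b, a - b}\<close> with \<open>2a = 0\<close> as well as
  \<open>{b, - b}\<close>.\<close>

lemma Y_obj_Ob:
  assumes "\<And>b. b \<in> P \<Longrightarrow> - b \<in> P"
  shows "Y_obj P \<in> Ob E"
proof -
  let ?N = "summands (fst (Y_obj P))"
  have "comp_over ?N (snd (Y_obj P)) (snd (Y_obj P)) = mat_id ?N"
  proof (intro ext)
    fix k i
    show "comp_over ?N (snd (Y_obj P)) (snd (Y_obj P)) k i = mat_id ?N k i"
    proof (cases "i \<in> ?N")
      case True
      then obtain b where b: "b \<in> P" "i = Leaf (SC b)" by auto
      have "comp_over ?N (snd (Y_obj P)) (snd (Y_obj P)) k i
          = (\<Sum>j\<in>?N. if j = Leaf (SC (- b)) then (if k = i then 1 else 0) else 0)"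
        unfolding comp_over_def using b assms by (intro sum.cong) auto
      also have "\<dots> = mat_id ?N k i" using b assms by (auto simp: mat_id_def)
      finally show ?thesis .
    qed (auto simp: comp_over_def mat_id_def intro!: sum.neutral)
  qed
  then show ?thesis using assms by (auto simp: Ob_E_iff mor_hom_def)
qed

lemma swap_eobj_Ob: "swap_eobj u \<in> Ob E"
proof -
  have "snd (swap_eobj u) \<in> mor_hom (obj_act (fst (swap_eobj u))) (fst (swap_eobj u))"
    by (auto simp: swap_eobj_def mor_hom_def)
  moreover have "comp_over (summands (fst (swap_eobj u))) (snd (swap_eobj u)) (snd (swap_eobj u))
      = mat_id (summands (fst (swap_eobj u)))"
    by (auto simp: swap_eobj_def comp_over_def mat_id_def fun_eq_iff)
  ultimately show ?thesis by (simp add: Ob_E_iff swap_eobj_def)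
qed

text \<open>For \<open>t \<noteq> - t\<close> the labels already tell the two summands apart, so
  dropping the tags \<open>InL\<close> and \<open>InR\<close> is a bijection.\<close>

lemma swap_eobj_iso_Y:
  assumes "t \<notin> two_torsion"
  shows "swap_eobj (SC t) \<cong>\<^bsub>E\<^esub> Y_obj {t, - t}"
proof (rule iso_relabel[where c = "\<lambda>_. 1" and g = "\<lambda>k. case k of InL i \<Rightarrow> i | InR i \<Rightarrow> i"])
  have t: "t \<noteq> - t" using assms by (metis (mono_tags) two_torsion_def mem_Collect_eq right_minus)
  show "Y_obj {t, - t} \<in> Ob E" by (rule Y_obj_Ob) auto
  show "bij_betw (\<lambda>k. case k of InL i \<Rightarrow> i | InR i \<Rightarrow> i) (summands (fst (swap_eobj (SC t))))
      (summands (fst (Y_obj {t, - t})))"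
    using t by (auto simp: bij_betw_def inj_on_def swap_eobj_def)
qed (use assms in \<open>auto simp: swap_eobj_def supported_def two_torsion_def eq_neg_iff_add_eq_0 neg_eq_iff_add_eq_0\<close>)

text \<open>Diagonalise the interchange by the matrix with rows \<open>(1, 1)\<close> and \<open>(1, -1)\<close>.\<close>

lemma swap_eobj_iso_simple:
  assumes u: "simple_act u = u"
  shows "swap_eobj u \<cong>\<^bsub>E\<^esub> simple_eobj u 1 \<oplus> simple_eobj u (-1)"
proof -
  let ?P = "swap_eobj u" and ?R = "simple_eobj u 1 \<oplus> simple_eobj u (-1)"
  let ?l = "InL (Leaf u)" and ?r = "InR (Leaf u)"
  define f :: "'g simple mor" where
    "f = (\<lambda>j i. if i \<in> {?l, ?r} \<and> j \<in> {?l, ?r} then if i = ?r \<and> j = ?r then -1 else 1 else 0)"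
  \<comment> \<open>On the two summands \<open>f\<close> squares to twice the identity, hence half
    of it is its inverse.\<close>
  define h where "h = (\<lambda>j i. f j i / 2)"
  have f: "f ?l ?l = 1" "f ?l ?r = 1" "f ?r ?l = 1" "f ?r ?r = -1"
    "\<And>i j. i \<noteq> ?l \<Longrightarrow> i \<noteq> ?r \<Longrightarrow> f j i = 0" "\<And>i j. j \<noteq> ?l \<Longrightarrow> j \<noteq> ?r \<Longrightarrow> f j i = 0"
    by (auto simp: f_def)
  have P: "summands (fst ?P) = {?l, ?r}" using u by (auto simp: swap_eobj_def)
  have R: "summands (fst ?R) = {?l, ?r}" by auto
  have lab: "label (fst ?P) i = u" "label (fst ?R) i = u" if "i \<in> {?l, ?r}" for i
    using that u by (auto simp: swap_eobj_def)
  have f_supp: "i \<in> {?l, ?r} \<and> j \<in> {?l, ?r}" if "f j i \<noteq> 0" for i j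
    using that f(5,6) by blast
  have fhom: "f \<in> mor_hom (fst ?P) (fst ?R)"
    unfolding mor_hom_def P R mem_Collect_eq
  proof (intro allI impI)
    fix j i assume "f j i \<noteq> 0"
    then have "i \<in> {?l, ?r}" "j \<in> {?l, ?r}" using f_supp by blast+
    with lab show "i \<in> {?l, ?r} \<and> j \<in> {?l, ?r} \<and> label (fst ?P) i = label (fst ?R) j"
      by metis
  qed
  have hhom: "h \<in> mor_hom (fst ?R) (fst ?P)"
    unfolding mor_hom_def P R mem_Collect_eq
  proof (intro allI impI)
    fix j i assume "h j i \<noteq> 0"
    then have "f j i \<noteq> 0" by (simp add: h_def)
    then have "i \<in> {?l, ?r}" "j \<in> {?l, ?r}" using f_supp by blast+
    with lab show "i \<in> {?l, ?r} \<and> j \<in> {?l, ?r} \<and> label (fst ?R) i = label (fst ?P) j"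
      by metis
  qed
  have "comp_over {?l, ?r} h f k i = mat_id {?l, ?r} k i"
      "comp_over {?l, ?r} f h k i = mat_id {?l, ?r} k i"
      "comp_over {?l, ?r} (snd ?R) f k i = comp_over {?l, ?r} f (snd ?P) k i" for k i
  proof -
    have sP: "snd ?P = (\<lambda>j i. if (i = ?l \<and> j = ?r) \<or> (j = ?l \<and> i = ?r) then 1 else 0)"
      using u by (simp add: swap_eobj_def)
    have sR: "snd ?R = (\<lambda>j i. if i = ?l \<and> j = ?l then 1 else if i = ?r \<and> j = ?r then -1 else 0)"
    proof (intro ext)
      fix j i show "snd ?R j i = (if i = ?l \<and> j = ?l then 1 else if i = ?r \<and> j = ?r then -1 else 0)"
        by (cases j; cases i) (simp_all add: snd_dsum block_mor_def)
    qed
    consider "i = ?l" | "i = ?r" | "i \<noteq> ?l" "i \<noteq> ?r" by blast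
    note ci = this
    consider "k = ?l" | "k = ?r" | "k \<noteq> ?l" "k \<noteq> ?r" by blast
    note ck = this
    show "comp_over {?l, ?r} h f k i = mat_id {?l, ?r} k i"
      by (rule ci; rule ck) (simp_all add: comp_over_def mat_id_def h_def f)
    show "comp_over {?l, ?r} f h k i = mat_id {?l, ?r} k i"
      by (rule ci; rule ck) (simp_all add: comp_over_def mat_id_def h_def f)
    show "comp_over {?l, ?r} (snd ?R) f k i = comp_over {?l, ?r} f (snd ?P) k i"
      by (rule ci; rule ck) (simp_all add: comp_over_def sP sR f)
  qed
  then have "comp_over {?l, ?r} h f = mat_id {?l, ?r}" "comp_over {?l, ?r} f h = mat_id {?l, ?r}"
      "comp_over {?l, ?r} (snd ?R) f = comp_over {?l, ?r} f (snd ?P)"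
    by (intro ext; simp)+
  moreover have "?R \<in> Ob E" using u by (intro dsum_Ob simple_eobj_Ob) auto
  ultimately show ?thesis
    unfolding isomorphic_E_iff P R using swap_eobj_Ob fhom hhom by blast
qed

section \<open>Tensor products\<close>

text \<open>Every class has a representative in the finite group \<Gamma>. This bounds the third
  entry of \<open>Ten\<close> and makes the summands of a tensor product finite in number.\<close>

lemma finite_UNIV_simple: "finite (UNIV :: 'g simple set)"
proof (rule finite_subset)
  have cls: "x \<in> range cls" for x :: "'g mod2" by (metis cls_rep rangeI)
  show "UNIV \<subseteq> SC ` (UNIV :: 'g set) \<union> SX ` range (cls :: 'g \<Rightarrow> _)"
  proof
    fix u :: "'g simple"
    show "u \<in> SC ` (UNIV :: 'g set) \<union> SX ` range (cls :: 'g \<Rightarrow> _)"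
      using cls by (cases u) blast+
  qed
  show "finite (SC ` (UNIV :: 'g set) \<union> SX ` range (cls :: 'g \<Rightarrow> _))"
    by simp
qed

lemma summands_tensor: "summands (fst (P \<otimes>\<^bsub>E\<^esub> R)) = {Ten i j u | i j u.
    i \<in> summands (fst P) \<and> j \<in> summands (fst R) \<and>
    u \<in> simple_tensor \<delta> (label (fst P) i) (label (fst R) j)}"
  by (simp add: equivariantisation_def crossed_category_def obj_tensor_def split: prod.splits)

lemma label_tensor [simp]: "label (fst (P \<otimes>\<^bsub>E\<^esub> R)) (Ten i j u) = u"
  by (simp add: equivariantisation_def crossed_category_def obj_tensor_def split: prod.splits)

lemma finite_summands_tensor:
  assumes "finite (summands A)" "finite (summands B)"
  shows "finite (summands (obj_tensor \<delta> A B :: 'g simple obj))"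
proof (rule finite_subset)
  show "summands (obj_tensor \<delta> A B) \<subseteq> (\<lambda>(i, j, u). Ten i j u) ` (summands A \<times> summands B \<times> UNIV)"
    by (auto simp: obj_tensor_def image_iff)
qed (use assms finite_UNIV_simple in simp)

text \<open>Each column of \<tau> has at most one nonzero entry, so the composite defining the
  structure of the product collapses to a product of three scalars.\<close>

lemma snd_tensor:
  assumes "finite (summands (fst P))" "finite (summands (fst R))"
  shows "snd (P \<otimes>\<^bsub>E\<^esub> R) k' k = (case (k', k) of
     (Ten i' j' u', Ten i j u) \<Rightarrow>
       if k \<in> summands (fst (P \<otimes>\<^bsub>E\<^esub> R)) \<and> k' \<in> summands (fst (P \<otimes>\<^bsub>E\<^esub> R)) \<and> u' = simple_act u
       then snd P i' i * snd R j' j * tau_coeff \<omega> \<delta> (label (fst P) i) (label (fst R) j) u else 0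
   | _ \<Rightarrow> 0)"
proof -
  let ?A = "fst P" and ?B = "fst R"
  let ?M = "mor_tensor \<delta> (obj_act ?A) ?A (obj_act ?B) ?B (snd P) (snd R)"
  let ?S = "summands (obj_tensor \<delta> (obj_act ?A) (obj_act ?B))"
  have S: "summands (fst (P \<otimes>\<^bsub>E\<^esub> R)) = summands (obj_tensor \<delta> ?A ?B)"
    by (simp add: equivariantisation_def crossed_category_def split: prod.splits)
  have fin: "finite ?S" using assms by (simp add: finite_summands_tensor)
  have comp: "snd (P \<otimes>\<^bsub>E\<^esub> R) k' k = (\<Sum>m\<in>?S. ?M k' m * mor_tau \<omega> \<delta> ?A ?B m k)"
    by (simp add: equivariantisation_def crossed_category_def mor_comp_def split: prod.splits)
  show ?thesis
  proof (cases "k \<in> summands (obj_tensor \<delta> ?A ?B)")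
    case False
    then have "mor_tau \<omega> \<delta> ?A ?B m k = 0" for m
      by (auto simp: mor_tau_def split: summand.splits)
    then show ?thesis using False
      by (auto simp: comp S split: summand.splits)
  next
    case True
    then obtain i j u where k: "k = Ten i j u" "i \<in> summands ?A" "j \<in> summands ?B"
      "u \<in> simple_tensor \<delta> (label ?A i) (label ?B j)" by (auto simp: obj_tensor_def)
    \<comment> \<open>The only row in which the column \<open>k\<close> of \<tau> can be
      nonzero.\<close>
    let ?m = "Ten i j (simple_act u)"
    let ?t = "tau_coeff \<omega> \<delta> (label ?A i) (label ?B j) u"
    have m: "?m \<in> ?S" using k simple_act_tensor by (auto simp: obj_tensor_def)
    have "mor_tau \<omega> \<delta> ?A ?B m k = (if m = ?m then ?t else 0)" for m
      using True by (auto simp: mor_tau_def k(1) split: summand.splits)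
    then have "snd (P \<otimes>\<^bsub>E\<^esub> R) k' k = (\<Sum>m\<in>?S. if m = ?m then ?M k' ?m * ?t else 0)"
      unfolding comp by (intro sum.cong) auto
    also have "\<dots> = ?M k' ?m * ?t" using fin m by simp
    finally show ?thesis
      using True m by (auto simp: mor_tensor_def S k(1) split: summand.splits)
  qed
qed

lemma supported_tensor:
  assumes "finite (summands (fst P))" "finite (summands (fst R))"
  shows "supported (summands (fst (P \<otimes>\<^bsub>E\<^esub> R))) (summands (fst (P \<otimes>\<^bsub>E\<^esub> R))) (snd (P \<otimes>\<^bsub>E\<^esub> R))"
  unfolding supported_def snd_tensor[OF assms] by (auto split: summand.splits if_splits)

section \<open>The signs \<omega> and the bilinear form on two-torsion\<close>

lemma \<omega>_square [simp]: "\<omega> a b c * \<omega> a b c = 1"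
  using \<omega>_values[of a b c] by auto

text \<open>A homomorphism into the group of signs takes equal values on inverse elements.\<close>

lemma \<omega>_uminus: "\<omega> (- a) b c = \<omega> a b c"
proof -
  have "\<omega> 0 b c = 1" using \<omega>_hom[of 0 0 b c] \<omega>_values[of 0 b c] by auto
  then have "\<omega> (- a) b c * \<omega> a b c = 1" using \<omega>_hom[of "- a" a b c] by simp
  then show ?thesis
    using \<omega>_values[of a b c] \<omega>_values[of "- a" b c] by auto
qed

text \<open>The formula for \<omega> in terms of \<sigma> is symmetric in the last two arguments.
  For \<open>c = - b\<close> this gives \<tau> the same sign at \<open>b\<close> and at
  \<open>- b\<close>, which is what allows an orbit to be normalised.\<close>

lemma \<omega>_swap: "\<omega> a b c = \<omega> a c b"
  by (simp add: \<omega>_\<sigma> add.commute)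

lemma bar3_values: "bar3 \<omega> x b c \<in> {1, -1}"
  unfolding bar3_def by (rule \<omega>_values)

lemma bar3_square [simp]: "bar3 \<omega> x b c * bar3 \<omega> x b c = 1"
  unfolding bar3_def by simp

lemma bar3_swap: "bar3 \<omega> x b c = bar3 \<omega> x c b"
  unfolding bar3_def by (rule \<omega>_swap)

text \<open>Squaring the functional equation of \<open>q\<close> gives \<open>B\<^sub>Q = \<sigma>\<^sup>2\<close>.\<close>

lemma bil_eq_\<sigma>_square: "bil Q a b = \<sigma> a b * \<sigma> a b"
proof -
  have "bil Q a b = (q (a + b) * inverse (q a) * inverse (q b))\<^sup>2"
    by (simp add: bil_def q_square[symmetric] power_mult_distrib power_inverse)
  also have "\<dots> = \<sigma> a b * \<sigma> a b * ((\<omega> (a + b) a b * \<omega> (a + b) a b) *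
      (bar3 \<omega> \<delta> a b * bar3 \<omega> \<delta> a b))"
    unfolding q_add power2_eq_square by (simp only: mult_ac)
  finally show ?thesis by simp
qed

lemma two_torsion_uminus: "a \<in> two_torsion \<Longrightarrow> - a = a"
  unfolding two_torsion_def by (simp add: minus_unique)

lemma two_torsion_iff: "a \<in> two_torsion \<longleftrightarrow> - a = a"
  by (simp add: two_torsion_def neg_eq_iff_add_eq_0)

lemma \<omega>_two_torsion:
  assumes "a \<in> two_torsion"
  shows "\<omega> x a (- a) = bil Q x a"
proof -
  have "\<omega> x a (- a) = inverse (\<sigma> x a) * inverse (\<sigma> x (- a))"
    \<comment> \<open>The numerator is
      \<open>\<sigma> x (a + - a) = \<sigma> x 0 = 1\<close>.\<close>
    using \<omega>_\<sigma>[of x a "- a"] by (simp add: \<sigma>_zero_right)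
  also have "\<dots> = inverse (bil Q x a)"
    by (simp add: two_torsion_uminus[OF assms] bil_eq_\<sigma>_square)
  finally have "bil Q x a = inverse (\<omega> x a (- a))" by simp
  then show ?thesis using \<omega>_values[of x a "- a"] by auto
qed

text \<open>Both extensions to classes evaluate at the same representative
  \<open>rep_mod2 x\<close>, so the identity on \<Gamma> carries over directly.\<close>

lemma bar3_two_torsion: "a \<in> two_torsion \<Longrightarrow> bar3 \<omega> x a (- a) = bar_bil Q x a"
  unfolding bar3_def bar_bil_def by (rule \<omega>_two_torsion)

lemma two_torsion_add: "a \<in> two_torsion \<Longrightarrow> b \<in> two_torsion \<Longrightarrow> a + b \<in> two_torsion"
  unfolding two_torsion_def by (simp add: algebra_simps)

lemma sign_mult: "s \<in> {1, -1} \<Longrightarrow> t \<in> {1, -1} \<Longrightarrow> s * t \<in> {1, -1 :: complex}"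
  by auto

lemma X_obj_Ob: "a \<in> two_torsion \<Longrightarrow> s \<in> {1, -1} \<Longrightarrow> X_obj a s \<in> Ob E"
  unfolding X_obj_eq by (intro simple_eobj_Ob) (auto simp: two_torsion_iff)

lemma Z_obj_Ob: "r \<in> {1, -1} \<Longrightarrow> Z_obj x r \<in> Ob E"
  unfolding Z_obj_eq by (intro simple_eobj_Ob) auto

text \<open>\<open>iso_relabel\<close> with the summands of a product listed as triples in
  \<open>N\<close>. Each fusion rule becomes a choice of \<open>g\<close> and \<open>c\<close>
  together with a check of the entries over \<open>N\<close>.\<close>

lemma iso_tensor_relabel:
  assumes R: "R \<in> Ob E" and fin: "finite (summands (fst P))" "finite (summands (fst P'))"
    and S: "summands (fst (P \<otimes>\<^bsub>E\<^esub> P')) = (\<lambda>(i, j, u). Ten i j u) ` N"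
    and bij: "bij_betw (\<lambda>(i, j, u). g i j u) N (summands (fst R))"
    and lab: "\<And>i j u. (i, j, u) \<in> N \<Longrightarrow> label (fst R) (g i j u) = u"
    and scale: "\<And>i j u. (i, j, u) \<in> N \<Longrightarrow> c i j u \<noteq> 0"
    and equi: "\<And>i j u i' j' u'. (i, j, u) \<in> N \<Longrightarrow> (i', j', u') \<in> N \<Longrightarrow>
      snd R (g i' j' u') (g i j u) * c i j u = c i' j' u' *
        (if u' = simple_act u
         then snd P i' i * snd P' j' j * tau_coeff \<omega> \<delta> (label (fst P) i) (label (fst P') j) u
         else 0)"
  shows "P \<otimes>\<^bsub>E\<^esub> P' \<cong>\<^bsub>E\<^esub> R"
proof (rule iso_relabel[OF R])
  \<comment> \<open>The default \<open>undefined\<close> is never reached, as all summands of a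
    product have the form \<open>Ten i j u\<close>.\<close>
  let ?g = "\<lambda>k. case k of Ten i j u \<Rightarrow> g i j u | _ \<Rightarrow> undefined"
  let ?c = "\<lambda>k. case k of Ten i j u \<Rightarrow> c i j u | _ \<Rightarrow> undefined"
  have "inj_on (\<lambda>(i, j, u). Ten i j u) N" by (auto simp: inj_on_def)
  then have T: "bij_betw (\<lambda>(i, j, u). Ten i j u) N (summands (fst (P \<otimes>\<^bsub>E\<^esub> P')))"
    unfolding S by (simp add: bij_betw_def)
  have g: "?g \<circ> (\<lambda>(i, j, u). Ten i j u) = (\<lambda>(i, j, u). g i j u)" by auto
  show "bij_betw ?g (summands (fst (P \<otimes>\<^bsub>E\<^esub> P'))) (summands (fst R))"
    by (subst bij_betw_comp_iff[OF T]) (simp only: g bij)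
  show "supported (summands (fst (P \<otimes>\<^bsub>E\<^esub> P'))) (summands (fst (P \<otimes>\<^bsub>E\<^esub> P'))) (snd (P \<otimes>\<^bsub>E\<^esub> P'))"
    by (rule supported_tensor[OF fin])
  fix k assume k: "k \<in> summands (fst (P \<otimes>\<^bsub>E\<^esub> P'))"
  then obtain i j u where iju: "k = Ten i j u" "(i, j, u) \<in> N" unfolding S by auto
  show "label (fst R) (?g k) = label (fst (P \<otimes>\<^bsub>E\<^esub> P')) k" using iju lab by simp
  show "?c k \<noteq> 0" using iju scale by simp
  fix k' assume k': "k' \<in> summands (fst (P \<otimes>\<^bsub>E\<^esub> P'))"
  then obtain i' j' u' where iju': "k' = Ten i' j' u'" "(i', j', u') \<in> N" unfolding S by auto
  show "snd R (?g k') (?g k) * ?c k = ?c k' * snd (P \<otimes>\<^bsub>E\<^esub> P') k' k"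
    using equi[OF iju(2) iju'(2)] k k' unfolding snd_tensor[OF fin] iju(1) iju'(1) by simp
qed

section \<open>Products with an \<open>X\<close>\<close>

lemma tensor_X_X:
  assumes "a \<in> two_torsion" "b \<in> two_torsion" "s \<in> {1, -1}" "t \<in> {1, -1}"
  shows "X_obj a s \<otimes>\<^bsub>E\<^esub> X_obj b t \<cong>\<^bsub>E\<^esub> X_obj (a + b) (s * t * \<omega> a b (- b))"
  unfolding X_obj_eq
proof (rule iso_tensor_relabel[where c = "\<lambda>_ _ _. 1" and g = "\<lambda>_ _ u. Leaf u"
      and N = "{(Leaf (SC a), Leaf (SC b), SC (a + b))}"])
  \<comment> \<open>The left side is the simplified form of \<open>- (a + b)\<close>: the single
    summand of the product is fixed by the action.\<close>
  have u: "- a - b = a + b"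
    using two_torsion_uminus[OF two_torsion_add[OF assms(1,2)]] by simp
  then show "simple_eobj (SC (a + b)) (s * t * \<omega> a b (- b)) \<in> Ob E"
    using assms(3,4) \<omega>_values by (intro simple_eobj_Ob sign_mult) auto
  show "\<And>i j u i' j' u'. (i, j, u) \<in> {(Leaf (SC a), Leaf (SC b), SC (a + b))} \<Longrightarrow>
      (i', j', u') \<in> {(Leaf (SC a), Leaf (SC b), SC (a + b))} \<Longrightarrow>
      snd (simple_eobj (SC (a + b)) (s * t * \<omega> a b (- b))) (Leaf u') (Leaf u) * 1 = 1 *
        (if u' = simple_act u
         then snd (simple_eobj (SC a) s) i' i * snd (simple_eobj (SC b) t) j' j *
           tau_coeff \<omega> \<delta> (label (fst (simple_eobj (SC a) s)) i)
             (label (fst (simple_eobj (SC b) t)) j) u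
         else 0)"
    using u by simp
qed (auto simp: summands_tensor)

lemma tensor_X_Z:
  assumes "a \<in> two_torsion" "s \<in> {1, -1}" "r \<in> {1, -1}"
  shows "X_obj a s \<otimes>\<^bsub>E\<^esub> Z_obj x r
    \<cong>\<^bsub>E\<^esub> Z_obj (cls a + x) (s * r * bar3 \<omega> (cls a + x) a (- a))"
  unfolding X_obj_eq Z_obj_eq
proof (rule iso_tensor_relabel[where c = "\<lambda>_ _ _. 1" and g = "\<lambda>_ _ u. Leaf u"
      and N = "{(Leaf (SC a), Leaf (SX x), SX (cls a + x))}"])
  show "simple_eobj (SX (cls a + x)) (s * r * bar3 \<omega> (cls a + x) a (- a)) \<in> Ob E"
    using assms bar3_values by (intro simple_eobj_Ob sign_mult) auto
qed (auto simp: summands_tensor)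

lemma tensor_X_Y:
  assumes a: "a \<in> two_torsion" and b: "b \<notin> two_torsion" and s: "s \<in> {1, -1}"
  shows "X_obj a s \<otimes>\<^bsub>E\<^esub> Y_obj {b, - b} \<cong>\<^bsub>E\<^esub> Y_obj {a + b, a - b}"
proof -
  \<comment> \<open>The scalar with which the structure of the product exchanges its two summands,
    in either direction. Rescaling the summand of \<open>- b\<close> by it turns both entries into
    1, since \<open>?w * ?w = 1\<close>.\<close>
  let ?w = "s * \<omega> a b (- b)"
  let ?N = "{(Leaf (SC a), Leaf (SC b), SC (a + b)), (Leaf (SC a), Leaf (SC (- b)), SC (a - b))}"
  have ma: "- a = a" by (rule two_torsion_uminus[OF a])
  \<comment> \<open>These equations show that \<open>{a + b, a - b}\<close> is a pair of the form
    \<open>{d, - d}\<close>.\<close>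
  have ma': "- a - b = a - b" "b - a = a + b"
    unfolding diff_conv_add_uminus by (simp_all only: ma add.commute)
  have "b \<noteq> - b" using b by (metis two_torsion_iff)
  then have bb: "b \<noteq> - b" "- b \<noteq> b" "a + b \<noteq> a - b" "a - b \<noteq> a + b"
    unfolding diff_conv_add_uminus by (auto dest: sym)
  have w: "?w \<noteq> 0" "?w * ?w = 1" "\<omega> a (- b) b = \<omega> a b (- b)"
    using s \<omega>_values[of a b "- b"] by (auto simp: \<omega>_swap)
  show ?thesis
    unfolding X_obj_eq
  proof (rule iso_tensor_relabel[where g = "\<lambda>_ _ u. Leaf u" and N = ?N
        and c = "\<lambda>i j u. if j = Leaf (SC b) then 1 else ?w"])
    show "Y_obj {a + b, a - b} \<in> Ob E"
      by (rule Y_obj_Ob) (auto simp: ma')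
    fix i j i' j' :: "'g simple summand" and u u' :: "'g simple"
    assume "(i, j, u) \<in> ?N" "(i', j', u') \<in> ?N"
    then show "snd (Y_obj {a + b, a - b}) (Leaf u') (Leaf u) * (if j = Leaf (SC b) then 1 else ?w) =
        (if j' = Leaf (SC b) then 1 else ?w) *
        (if u' = simple_act u
         then snd (simple_eobj (SC a) s) i' i * snd (Y_obj {b, - b}) j' j *
           tau_coeff \<omega> \<delta> (label (fst (simple_eobj (SC a) s)) i) (label (fst (Y_obj {b, - b})) j) u
         else 0)"
      by (elim insertE emptyE) (use bb w(2) in \<open>simp_all add: ma' w(3)\<close>)
  qed (use bb w(1) in \<open>auto simp: summands_tensor bij_betw_def\<close>)
qed

section \<open>Products of a \<open>Y\<close> with a \<open>Z\<close> or another
  \<open>Y\<close>\<close>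

lemma swap_eobj_simps [simp]:
  "summands (fst (swap_eobj u)) = {InL (Leaf u), InR (Leaf (simple_act u))}"
  "label (fst (swap_eobj u)) (InL (Leaf v)) = v"
  "label (fst (swap_eobj u)) (InR (Leaf v)) = v"
  "snd (swap_eobj u) = (\<lambda>j i. if (i = InL (Leaf u) \<and> j = InR (Leaf (simple_act u))) \<or>
              (j = InL (Leaf u) \<and> i = InR (Leaf (simple_act u))) then 1 else 0)"
  by (auto simp: swap_eobj_def)

text \<open>The two summands are interchanged but carry the same fixed label, because
  \<open>a\<close> and \<open>- a\<close> have the same class. After normalisation this is
  \<open>swap_eobj\<close> of a fixed label, which splits into both signs.\<close>

lemma tensor_Y_Z:
  assumes a: "a \<notin> two_torsion" and r: "r \<in> {1, -1}"
  shows "Y_obj {a, - a} \<otimes>\<^bsub>E\<^esub> Z_obj x r \<cong>\<^bsub>E\<^esub> Z_obj (x + cls a) 1 \<oplus> Z_obj (x + cls a) (-1)"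
proof -
  let ?v = "SX (cls a + x)" and ?w = "r * bar3 \<omega> (cls a + x) a (- a)"
  let ?N = "{(Leaf (SC a), Leaf (SX x), ?v), (Leaf (SC (- a)), Leaf (SX x), ?v)}"
  have aa: "a \<noteq> - a" "- a \<noteq> a" using a by (metis two_torsion_iff)+
  have w: "?w \<noteq> 0" "?w * ?w = 1" "bar3 \<omega> (cls a + x) (- a) a = bar3 \<omega> (cls a + x) a (- a)"
    using r bar3_values[of "cls a + x" a "- a"] by (auto simp: bar3_swap)
  have "Y_obj {a, - a} \<otimes>\<^bsub>E\<^esub> simple_eobj (SX x) r \<cong>\<^bsub>E\<^esub> swap_eobj ?v"
  proof (rule iso_tensor_relabel[where N = ?N
        and g = "\<lambda>i j u. if i = Leaf (SC a) then InL (Leaf u) else InR (Leaf u)"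
        and c = "\<lambda>i j u. if i = Leaf (SC a) then 1 else ?w"])
    fix i j i' j' :: "'g simple summand" and u u' :: "'g simple"
    assume "(i, j, u) \<in> ?N" "(i', j', u') \<in> ?N"
    then show "snd (swap_eobj ?v) (if i' = Leaf (SC a) then InL (Leaf u') else InR (Leaf u'))
          (if i = Leaf (SC a) then InL (Leaf u) else InR (Leaf u)) *
        (if i = Leaf (SC a) then 1 else ?w) =
        (if i' = Leaf (SC a) then 1 else ?w) *
        (if u' = simple_act u
         then snd (Y_obj {a, - a}) i' i * snd (simple_eobj (SX x) r) j' j *
           tau_coeff \<omega> \<delta> (label (fst (Y_obj {a, - a})) i) (label (fst (simple_eobj (SX x) r)) j) u
         else 0)"
      by (elim insertE emptyE) (use aa w(2) in \<open>simp_all add: w(3)\<close>)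
  qed (use aa w(1) in \<open>auto simp: summands_tensor bij_betw_def swap_eobj_Ob\<close>)
  moreover have "swap_eobj ?v \<cong>\<^bsub>E\<^esub> simple_eobj ?v 1 \<oplus> simple_eobj ?v (-1)"
    by (rule swap_eobj_iso_simple) simp
  ultimately show ?thesis
    unfolding Z_obj_eq add.commute[of x] by (rule iso_trans)
qed

text \<open>The four summands form two orbits under negation. Keeping them as
  \<open>swap_eobj\<close> postpones the question whether \<open>b + c\<close> and
  \<open>b - c\<close> are two-torsion.\<close>

lemma tensor_Y_Y:
  assumes b: "b \<notin> two_torsion" and c: "c \<notin> two_torsion"
  shows "Y_obj {b, - b} \<otimes>\<^bsub>E\<^esub> Y_obj {c, - c} \<cong>\<^bsub>E\<^esub> swap_eobj (SC (b + c)) \<oplus> swap_eobj (SC (b - c))"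
proof -
  \<comment> \<open>By \<open>\<omega>_uminus\<close> and \<open>\<omega>_swap\<close> this one sign
    is the value of \<tau> on all four summands.\<close>
  let ?w = "\<omega> b c (- c)"
  let ?N = "{(Leaf (SC b), Leaf (SC c), SC (b + c)), (Leaf (SC b), Leaf (SC (- c)), SC (b - c)),
    (Leaf (SC (- b)), Leaf (SC c), SC (c - b)), (Leaf (SC (- b)), Leaf (SC (- c)), SC (- b - c))}"
  \<comment> \<open>The outer tag selects the orbit, \<open>InL\<close> for that of
    \<open>b + c\<close> and \<open>InR\<close> for that of \<open>b - c\<close>. The inner tag
    records whether the first factor is \<open>b\<close> or \<open>- b\<close>, and the summands of
    \<open>- b\<close> are the rescaled ones.\<close>
  let ?g = "\<lambda>i j u. if i = Leaf (SC b)
      then if j = Leaf (SC c) then InL (InL (Leaf u)) else InR (InL (Leaf u))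
      else if j = Leaf (SC c) then InR (InR (Leaf u)) else InL (InR (Leaf u))"
  let ?R = "swap_eobj (SC (b + c)) \<oplus> swap_eobj (SC (b - c))"
  have ne: "b \<noteq> - b" "- b \<noteq> b" "c \<noteq> - c" "- c \<noteq> c"
    using b c by (metis two_torsion_iff)+
  have w: "?w \<noteq> 0" "?w * ?w = 1" "\<omega> b (- c) c = ?w"
    using \<omega>_values[of b c "- c"] by (auto simp: \<omega>_swap)
  show ?thesis
  proof (rule iso_tensor_relabel[where N = ?N and g = ?g
        and c = "\<lambda>i j u. if i = Leaf (SC b) then 1 else ?w"])
    show "?R \<in> Ob E" by (intro dsum_Ob swap_eobj_Ob)
    show "summands (fst (Y_obj {b, - b} \<otimes>\<^bsub>E\<^esub> Y_obj {c, - c})) = (\<lambda>(i, j, u). Ten i j u) ` ?N"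
      by (auto simp: summands_tensor)
    show "bij_betw (\<lambda>(i, j, u). ?g i j u) ?N (summands (fst ?R))"
      using ne by (simp add: bij_betw_def insert_commute)
    fix i j i' j' :: "'g simple summand" and u u' :: "'g simple"
    assume i: "(i, j, u) \<in> ?N"
    then show "label (fst ?R) (?g i j u) = u"
      by (elim insertE emptyE) (use ne in simp_all)
    show "(if i = Leaf (SC b) then 1 else ?w) \<noteq> 0" using w(1) by simp
    assume "(i', j', u') \<in> ?N"
    with i show "snd ?R (?g i' j' u') (?g i j u) * (if i = Leaf (SC b) then 1 else ?w) =
        (if i' = Leaf (SC b) then 1 else ?w) *
        (if u' = simple_act u
         then snd (Y_obj {b, - b}) i' i * snd (Y_obj {c, - c}) j' j *
           tau_coeff \<omega> \<delta> (label (fst (Y_obj {b, - b})) i) (label (fst (Y_obj {c, - c})) j) u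
         else 0)"
      by (elim insertE emptyE) (use ne w(2) in \<open>simp_all add: w(3) snd_dsum \<omega>_uminus\<close>)
  qed simp_all
qed

section \<open>Products of two \<open>Z\<close>\<close>

lemma Dsum_simps [simp]:
  "summands (fst (Dsum S F)) = {At (SC t) i | t i. t \<in> S \<and> i \<in> summands (fst (F t))}"
  "label (fst (Dsum S F)) (At (SC t) i) = label (fst (F t)) i"
  "snd (Dsum S F) (At (SC t') i') (At (SC t) i) =
    (if t' = t \<and> t \<in> S then snd (F t) i' i else 0)"
  by (simp_all add: Dsum_def)

text \<open>This is an equality, although the label function of \<open>Dsum\<close> reads the family
  outside \<open>S\<close> too: the underlying object of \<open>X_obj\<close> does not depend on the
  sign, and the matrix is cut off to \<open>S\<close>.\<close>

lemma Dsum_X_cong: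
  assumes "\<And>t. t \<in> S \<Longrightarrow> f t = g t"
  shows "Dsum S (\<lambda>t. X_obj t (f t)) = Dsum S (\<lambda>t. X_obj t (g t))"
  unfolding Dsum_def X_obj_def using assms
  by (auto simp: fun_eq_iff split: summand.splits graded_simple.splits)

lemma Z_Z_target_Ob:
  assumes "r \<in> {1, -1}" "s \<in> {1, -1}"
  shows "Dsum {t \<in> two_torsion. cls t = z} (\<lambda>t. X_obj t (r * s * bar3 \<omega> x t (- t)))
    \<oplus> Dsum {t \<in> T. cls t = z} (\<lambda>t. Y_obj {t, - t}) \<in> Ob E"
  unfolding X_obj_eq
proof (intro dsum_Ob Dsum_Ob simple_eobj_Ob Y_obj_Ob sign_mult bar3_values)
  fix t assume "t \<in> {t \<in> two_torsion. cls t = z}"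
  then show "simple_act (SC t) = SC t" by (simp add: two_torsion_iff)
qed (use assms in auto)

text \<open>The product has one summand for each \<open>t\<close> in the class
  \<open>\<delta> + x + y\<close>, and negation permutes this class. Fixed points give the
  \<open>X\<close> terms, and \<open>T\<close> picks the member of each remaining orbit that indexes
  its \<open>Y\<close>.\<close>

lemma tensor_Z_Z:
  assumes r: "r \<in> {1, -1}" and s: "s \<in> {1, -1}"
    and T: "T \<subseteq> - two_torsion" and half: "\<And>t. t \<notin> two_torsion \<Longrightarrow> (t \<in> T) \<noteq> (- t \<in> T)"
  shows "Z_obj x r \<otimes>\<^bsub>E\<^esub> Z_obj y s \<cong>\<^bsub>E\<^esub>
    Dsum {t \<in> two_torsion. cls t = \<delta> + x + y} (\<lambda>t. X_obj t (r * s * bar3 \<omega> x t (- t)))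
      \<oplus> Dsum {t \<in> T. cls t = \<delta> + x + y} (\<lambda>t. Y_obj {t, - t})"
proof -
  let ?P = "simple_eobj (SX x) r" and ?P' = "simple_eobj (SX y) s"
  let ?A = "{t \<in> two_torsion. cls t = \<delta> + x + y}" and ?B = "{t \<in> T. cls t = \<delta> + x + y}"
  \<comment> \<open>The scalar with which the structure of the product takes the summand
    \<open>t\<close> to the summand \<open>- t\<close>.\<close>
  define w where "w t = r * s * bar3 \<omega> x t (- t)" for t
  let ?L = "Dsum ?A (\<lambda>t. simple_eobj (SC t) (w t))" and ?M = "Dsum ?B (\<lambda>t. Y_obj {t, - t})"
  \<comment> \<open>Both members of an orbit go to the component indexed by its member in
    \<open>T\<close>; the leaf keeps their labels apart.\<close>
  define G :: "'g \<Rightarrow> 'g simple summand" where "G t = (if t \<in> two_torsion then InL (At (SC t) (Leaf (SC t)))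
      else if t \<in> T then InR (At (SC t) (Leaf (SC t))) else InR (At (SC (- t)) (Leaf (SC t))))"
    for t :: 'g
  \<comment> \<open>Only the member outside \<open>T\<close> is rescaled. Since
    \<open>w (- t) = w t\<close> squares to 1, this normalises both entries of the orbit.\<close>
  define C where "C t = (if t \<in> two_torsion \<or> t \<in> T then 1 else w t)" for t
  define N :: "('g simple summand \<times> 'g simple summand \<times> 'g simple) set"
    where "N = {(Leaf (SX x), Leaf (SX y), SC t) | t. cls t = \<delta> + x + y}"
  let ?g = "\<lambda>i j u. case u of SC t \<Rightarrow> G t | _ \<Rightarrow> undefined"
  let ?c = "\<lambda>i j u. case u of SC t \<Rightarrow> C t | _ \<Rightarrow> undefined"
  have w: "w t \<noteq> 0" "w t * w t = 1" "w (- t) = w t" for t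
    using r s bar3_values[of x t "- t"] by (auto simp: w_def bar3_swap[of x "- t" t])
  have C: "C t \<noteq> 0" for t using w by (simp add: C_def)
  have tors: "- t \<in> two_torsion \<longleftrightarrow> t \<in> two_torsion" for t :: 'g
    by (auto simp: two_torsion_iff)
  have bij: "bij_betw (\<lambda>(i, j, u). ?g i j u) N (summands (fst (?L \<oplus> ?M)))"
  proof -
    have "inj_on (\<lambda>(i, j, u). ?g i j u) N"
      by (auto simp: inj_on_def N_def G_def split: if_splits)
    moreover have "G ` {t. cls t = \<delta> + x + y} = summands (fst (?L \<oplus> ?M))"
    proof
      show "G ` {t. cls t = \<delta> + x + y} \<subseteq> summands (fst (?L \<oplus> ?M))"
        using half by (auto simp: G_def)
      have G: "t \<in> two_torsion \<Longrightarrow> G t = InL (At (SC t) (Leaf (SC t)))"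
        "t \<in> T \<Longrightarrow> G t = InR (At (SC t) (Leaf (SC t)))"
        "t \<in> T \<Longrightarrow> G (- t) = InR (At (SC t) (Leaf (SC (- t))))" for t
        using T half[of t] tors[of t] by (auto simp: G_def)
      show "summands (fst (?L \<oplus> ?M)) \<subseteq> G ` {t. cls t = \<delta> + x + y}"
      proof
        fix k assume "k \<in> summands (fst (?L \<oplus> ?M))"
        then consider t where "t \<in> ?A" "k = InL (At (SC t) (Leaf (SC t)))"
          | t where "t \<in> ?B" "k = InR (At (SC t) (Leaf (SC t)))"
          | t where "t \<in> ?B" "k = InR (At (SC t) (Leaf (SC (- t))))"
          by auto
        then show "k \<in> G ` {t. cls t = \<delta> + x + y}"
        proof cases
          case (1 t) then show ?thesis using G(1)[of t] by (intro image_eqI[of _ _ t]) simp_all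
        next
          case (2 t) then show ?thesis using G(2)[of t] by (intro image_eqI[of _ _ t]) simp_all
        next
          case (3 t) then show ?thesis using G(3)[of t] by (intro image_eqI[of _ _ "- t"]) simp_all
        qed
      qed
    qed
    moreover have "(\<lambda>(i, j, u). ?g i j u) ` N = G ` {t. cls t = \<delta> + x + y}"
    proof -
      have "N = (\<lambda>t. (Leaf (SX x), Leaf (SX y), SC t)) ` {t. cls t = \<delta> + x + y}"
        by (auto simp: N_def)
      then show ?thesis by (simp add: image_image)
    qed
    ultimately show ?thesis by (simp only: bij_betw_def)
  qed
  have equi: "snd (?L \<oplus> ?M) (G t') (G t) * C t = C t' * (if t' = - t then w t else 0)"
    if "cls t = \<delta> + x + y" "cls t' = \<delta> + x + y" for t t'
  proof (cases "t \<in> two_torsion")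
    case True
    then show ?thesis
      using that by (auto simp: G_def C_def snd_dsum two_torsion_iff)
  next
    case False
    then have "t \<noteq> - t" "- t \<noteq> t" by (metis two_torsion_iff)+
    show ?thesis
    proof (cases "t' = - t")
      case True
      then show ?thesis
        using that False half[OF False] tors w \<open>t \<noteq> - t\<close> by (auto simp: G_def C_def snd_dsum)
    next
      case neq: False
      then have "t \<noteq> - t'" by auto
      with neq show ?thesis
        using False \<open>t \<noteq> - t\<close> by (auto simp: G_def snd_dsum)
    qed
  qed
  have "?P \<otimes>\<^bsub>E\<^esub> ?P' \<cong>\<^bsub>E\<^esub> ?L \<oplus> ?M"
  proof (rule iso_tensor_relabel[where N = N and g = ?g and c = ?c, OF _ _ _ _ bij])
    show "?L \<oplus> ?M \<in> Ob E"
      using Z_Z_target_Ob[OF r s, of "\<delta> + x + y" x T] by (simp add: X_obj_eq w_def)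
    show "summands (fst (?P \<otimes>\<^bsub>E\<^esub> ?P')) = (\<lambda>(i, j, u). Ten i j u) ` N"
      by (auto simp: summands_tensor N_def image_iff)
    fix i j i' j' :: "'g simple summand" and u u' :: "'g simple"
    assume i: "(i, j, u) \<in> N"
    then show "label (fst (?L \<oplus> ?M)) (?g i j u) = u" by (auto simp: N_def G_def)
    show "?c i j u \<noteq> 0" using i C by (auto simp: N_def)
    assume "(i', j', u') \<in> N"
    with i obtain t t' where "i = Leaf (SX x)" "j = Leaf (SX y)" "u = SC t" "cls t = \<delta> + x + y"
      "i' = Leaf (SX x)" "j' = Leaf (SX y)" "u' = SC t'" "cls t' = \<delta> + x + y"
      by (auto simp: N_def)
    with equi[of t t'] show "snd (?L \<oplus> ?M) (?g i' j' u') (?g i j u) * ?c i j u = ?c i' j' u' *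
        (if u' = simple_act u
         then snd ?P i' i * snd ?P' j' j * tau_coeff \<omega> \<delta> (label (fst ?P) i) (label (fst ?P') j) u
         else 0)"
      by (simp add: w_def)
  qed simp_all
  then show ?thesis by (simp add: X_obj_eq Z_obj_eq w_def)
qed

text \<open>Each of the two orbits becomes a \<open>Y\<close> if its labels differ and a pair of
  \<open>X\<close> if they coincide.\<close>

lemma tensor_Y_Y_cases:
  assumes b: "b \<notin> two_torsion" and c: "c \<notin> two_torsion"
  shows "Y_obj {b, - b} \<otimes>\<^bsub>E\<^esub> Y_obj {c, - c} \<cong>\<^bsub>E\<^esub>
    (if b + c \<in> two_torsion \<and> b - c \<in> two_torsion
     then X_obj (b + c) 1 \<oplus> X_obj (b + c) (-1) \<oplus> X_obj (b - c) 1 \<oplus> X_obj (b - c) (-1)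
     else if b + c \<notin> two_torsion \<and> b - c \<in> two_torsion
     then Y_obj {b + c, - b - c} \<oplus> X_obj (b - c) 1 \<oplus> X_obj (b - c) (-1)
     else if b + c \<in> two_torsion \<and> b - c \<notin> two_torsion
     then Y_obj {b - c, - b + c} \<oplus> X_obj (b + c) 1 \<oplus> X_obj (b + c) (-1)
     else Y_obj {b + c, - b - c} \<oplus> Y_obj {b - c, - b + c})" (is "?YY \<cong>\<^bsub>E\<^esub> ?R")
proof -
  have X: "swap_eobj (SC t) \<cong>\<^bsub>E\<^esub> X_obj t 1 \<oplus> X_obj t (-1)" if "t \<in> two_torsion" for t
    unfolding X_obj_eq using that by (intro swap_eobj_iso_simple) (simp add: two_torsion_iff)
  have Y_plus: "swap_eobj (SC (b + c)) \<cong>\<^bsub>E\<^esub> Y_obj {b + c, - b - c}" if "b + c \<notin> two_torsion"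
    using swap_eobj_iso_Y[OF that] by simp
  have Y_minus: "swap_eobj (SC (b - c)) \<cong>\<^bsub>E\<^esub> Y_obj {b - c, - b + c}" if "b - c \<notin> two_torsion"
    using swap_eobj_iso_Y[OF that] by (simp add: add.commute)
  have YY: "?YY \<cong>\<^bsub>E\<^esub> swap_eobj (SC (b + c)) \<oplus> swap_eobj (SC (b - c))"
    by (rule tensor_Y_Y[OF b c])
  \<comment> \<open>Replacing \<open>c\<close> by \<open>- c\<close> leaves the second factor
    unchanged but exchanges the orbits. This puts the \<open>Y\<close> first in the third case
    without a commutativity law for \<open>\<oplus>\<close>.\<close>
  have "- c \<notin> two_torsion" using c by (auto simp: two_torsion_iff)
  from tensor_Y_Y[OF b this]
  have YY': "?YY \<cong>\<^bsub>E\<^esub> swap_eobj (SC (b - c)) \<oplus> swap_eobj (SC (b + c))"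
    by (simp add: insert_commute)
  consider "b + c \<in> two_torsion" "b - c \<in> two_torsion" | "b + c \<notin> two_torsion" "b - c \<in> two_torsion"
    | "b + c \<in> two_torsion" "b - c \<notin> two_torsion" | "b + c \<notin> two_torsion" "b - c \<notin> two_torsion"
    by blast
  then show ?thesis
  proof cases
    case 1
    have "?YY \<cong>\<^bsub>E\<^esub> (X_obj (b + c) 1 \<oplus> X_obj (b + c) (-1)) \<oplus> X_obj (b - c) 1 \<oplus> X_obj (b - c) (-1)"
      by (rule iso_trans[OF YY dsum_cong[OF X[OF 1(1)] X[OF 1(2)]]])
    moreover have "(X_obj (b + c) 1 \<oplus> X_obj (b + c) (-1)) \<oplus> X_obj (b - c) 1 \<oplus> X_obj (b - c) (-1)
        \<cong>\<^bsub>E\<^esub> X_obj (b + c) 1 \<oplus> X_obj (b + c) (-1) \<oplus> X_obj (b - c) 1 \<oplus> X_obj (b - c) (-1)"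
      using 1 by (intro dsum_assoc dsum_Ob X_obj_Ob) auto
    ultimately show ?thesis using 1 iso_trans by simp
  next
    case 2
    then show ?thesis using iso_trans[OF YY dsum_cong[OF Y_plus X]] by simp
  next
    case 3
    then show ?thesis using iso_trans[OF YY' dsum_cong[OF Y_minus X]] by simp
  next
    case 4
    then show ?thesis using iso_trans[OF YY dsum_cong[OF Y_plus Y_minus]] by simp
  qed
qed

end

section \<open>The fusion rules\<close>

theorem proposition5p16:
  fixes Q :: "'g::{finite, ab_group_add} \<Rightarrow> complex"
    and \<sigma> :: "'g \<Rightarrow> 'g \<Rightarrow> complex"
    and \<omega> :: "'g \<Rightarrow> 'g \<Rightarrow> 'g \<Rightarrow> complex"
    and \<delta> :: "'g mod2"
    and q :: "'g \<Rightarrow> complex"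
    and \<epsilon> \<alpha> \<beta> :: complex
    and D :: "('g simple eobj, 'g simple mor) tensor_cat"
  assumes data: "crossed_input Q \<sigma> \<omega> \<delta> q \<epsilon> \<alpha> \<beta>"
    and D: "D = equivariantisation (crossed_category \<sigma> \<omega> \<delta> q \<epsilon> \<alpha> \<beta>)"
  shows
    "(\<forall>a\<in>two_torsion. \<forall>b\<in>two_torsion. \<forall>s\<in>{1, -1}. \<forall>t\<in>{1, -1}.
        X_obj a s \<otimes>\<^bsub>D\<^esub> X_obj b t \<cong>\<^bsub>D\<^esub> X_obj (a + b) (s * t * \<omega> a b (- b)) \<and>
        X_obj (a + b) (s * t * \<omega> a b (- b)) \<cong>\<^bsub>D\<^esub> X_obj (a + b) (s * t * bil Q a b)) \<and>
     (\<forall>a\<in>two_torsion. \<forall>b\<in>- two_torsion. \<forall>s\<in>{1, -1}.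
        X_obj a s \<otimes>\<^bsub>D\<^esub> Y_obj {b, - b} \<cong>\<^bsub>D\<^esub> Y_obj {a + b, a - b}) \<and>
     (\<forall>a\<in>two_torsion. \<forall>x. \<forall>s\<in>{1, -1}. \<forall>r\<in>{1, -1}.
        X_obj a s \<otimes>\<^bsub>D\<^esub> Z_obj x r
          \<cong>\<^bsub>D\<^esub> Z_obj (cls a + x) (s * r * bar3 \<omega> (cls a + x) a (- a)) \<and>
        Z_obj (cls a + x) (s * r * bar3 \<omega> (cls a + x) a (- a))
          \<cong>\<^bsub>D\<^esub> Z_obj (cls a + x) (s * r * bar_bil Q (cls a + x) a)) \<and>
     (\<forall>a\<in>- two_torsion. \<forall>x. \<forall>r\<in>{1, -1}.
        Y_obj {a, - a} \<otimes>\<^bsub>D\<^esub> Z_obj x r \<cong>\<^bsub>D\<^esub> Z_obj (x + cls a) 1 \<oplus> Z_obj (x + cls a) (-1)) \<and>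
     (\<forall>b\<in>- two_torsion. \<forall>c\<in>- two_torsion.
        Y_obj {b, - b} \<otimes>\<^bsub>D\<^esub> Y_obj {c, - c} \<cong>\<^bsub>D\<^esub>
          (if b + c \<in> two_torsion \<and> b - c \<in> two_torsion
           then X_obj (b + c) 1 \<oplus> X_obj (b + c) (-1) \<oplus> X_obj (b - c) 1 \<oplus> X_obj (b - c) (-1)
           else if b + c \<notin> two_torsion \<and> b - c \<in> two_torsion
           then Y_obj {b + c, - b - c} \<oplus> X_obj (b - c) 1 \<oplus> X_obj (b - c) (-1)
           else if b + c \<in> two_torsion \<and> b - c \<notin> two_torsion
           then Y_obj {b - c, - b + c} \<oplus> X_obj (b + c) 1 \<oplus> X_obj (b + c) (-1)
           else Y_obj {b + c, - b - c} \<oplus> Y_obj {b - c, - b + c})) \<and>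
     (\<forall>x y. \<forall>r\<in>{1, -1}. \<forall>s\<in>{1, -1}. \<forall>T.
        T \<subseteq> - two_torsion \<and> (\<forall>t\<in>- two_torsion. (t \<in> T) \<noteq> (- t \<in> T)) \<longrightarrow>
        Z_obj x r \<otimes>\<^bsub>D\<^esub> Z_obj y s \<cong>\<^bsub>D\<^esub>
          Dsum {t \<in> two_torsion. cls t = \<delta> + x + y} (\<lambda>t. X_obj t (r * s * bar3 \<omega> x t (- t)))
            \<oplus> Dsum {t \<in> T. cls t = \<delta> + x + y} (\<lambda>t. Y_obj {t, - t}) \<and>
        Dsum {t \<in> two_torsion. cls t = \<delta> + x + y} (\<lambda>t. X_obj t (r * s * bar3 \<omega> x t (- t)))
            \<oplus> Dsum {t \<in> T. cls t = \<delta> + x + y} (\<lambda>t. Y_obj {t, - t}) \<cong>\<^bsub>D\<^esub>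
          Dsum {t \<in> two_torsion. cls t = \<delta> + x + y} (\<lambda>t. X_obj t (r * s * bar_bil Q x t))
            \<oplus> Dsum {t \<in> T. cls t = \<delta> + x + y} (\<lambda>t. Y_obj {t, - t}))"
proof -
  interpret crossed_input Q \<sigma> \<omega> \<delta> q \<epsilon> \<alpha> \<beta> by (rule data)
  have XX: "X_obj a s \<otimes>\<^bsub>D\<^esub> X_obj b t \<cong>\<^bsub>D\<^esub> X_obj (a + b) (s * t * \<omega> a b (- b)) \<and>
      X_obj (a + b) (s * t * \<omega> a b (- b)) \<cong>\<^bsub>D\<^esub> X_obj (a + b) (s * t * bil Q a b)"
    if "a \<in> two_torsion" "b \<in> two_torsion" "s \<in> {1, -1}" "t \<in> {1, -1}" for a b s t
    \<comment> \<open>Turning \<open>bil Q a b\<close> back into \<omega> makes the second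
      isomorphism an instance of reflexivity; the same is done for \<open>Z_obj\<close>
      below.\<close>
    unfolding D \<omega>_two_torsion[OF that(2), symmetric]
    using that by (intro conjI tensor_X_X iso_refl X_obj_Ob two_torsion_add sign_mult \<omega>_values)
  have XZ: "X_obj a s \<otimes>\<^bsub>D\<^esub> Z_obj x r
        \<cong>\<^bsub>D\<^esub> Z_obj (cls a + x) (s * r * bar3 \<omega> (cls a + x) a (- a)) \<and>
      Z_obj (cls a + x) (s * r * bar3 \<omega> (cls a + x) a (- a))
        \<cong>\<^bsub>D\<^esub> Z_obj (cls a + x) (s * r * bar_bil Q (cls a + x) a)"
    if "a \<in> two_torsion" "s \<in> {1, -1}" "r \<in> {1, -1}" for a x s r
    unfolding D bar3_two_torsion[OF that(1), symmetric]
    using that by (intro conjI tensor_X_Z iso_refl Z_obj_Ob sign_mult bar3_values)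
  have ZZ: "Z_obj x r \<otimes>\<^bsub>D\<^esub> Z_obj y s \<cong>\<^bsub>D\<^esub>
        Dsum {t \<in> two_torsion. cls t = \<delta> + x + y} (\<lambda>t. X_obj t (r * s * bar3 \<omega> x t (- t)))
          \<oplus> Dsum {t \<in> T. cls t = \<delta> + x + y} (\<lambda>t. Y_obj {t, - t}) \<and>
      Dsum {t \<in> two_torsion. cls t = \<delta> + x + y} (\<lambda>t. X_obj t (r * s * bar3 \<omega> x t (- t)))
          \<oplus> Dsum {t \<in> T. cls t = \<delta> + x + y} (\<lambda>t. Y_obj {t, - t}) \<cong>\<^bsub>D\<^esub>
        Dsum {t \<in> two_torsion. cls t = \<delta> + x + y} (\<lambda>t. X_obj t (r * s * bar_bil Q x t))
          \<oplus> Dsum {t \<in> T. cls t = \<delta> + x + y} (\<lambda>t. Y_obj {t, - t})"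
    if r: "r \<in> {1, -1}" and s: "s \<in> {1, -1}"
      and T: "T \<subseteq> - two_torsion \<and> (\<forall>t\<in>- two_torsion. (t \<in> T) \<noteq> (- t \<in> T))" for x y r s T
  proof -
    \<comment> \<open>The equality of signs is available only at two-torsion \<open>t\<close>, so it
      enters through congruence over the index set.\<close>
    have eq: "Dsum {t \<in> two_torsion. cls t = \<delta> + x + y} (\<lambda>t. X_obj t (r * s * bar_bil Q x t)) =
        Dsum {t \<in> two_torsion. cls t = \<delta> + x + y} (\<lambda>t. X_obj t (r * s * bar3 \<omega> x t (- t)))"
      by (rule Dsum_X_cong) (simp add: bar3_two_torsion)
    show ?thesis
      unfolding D eq using T by (intro conjI tensor_Z_Z iso_refl Z_Z_target_Ob r s) auto
  qed
  show ?thesis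
    \<comment> \<open>The nested rule splits exactly the six outer conjuncts and leaves the inner
      pairs whole, in the shape of \<open>XX\<close>, \<open>XZ\<close> and
      \<open>ZZ\<close>.\<close>
    by (intro conjI[OF _ conjI[OF _ conjI[OF _ conjI[OF _ conjI]]]] ballI allI impI)
      (use XX XZ ZZ tensor_X_Y tensor_Y_Z tensor_Y_Y_cases in \<open>simp_all only: D Compl_iff\<close>)
qed

end
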